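(* There is an absolute constant $C>0$ such that for every integer $n\ge 2$ and any distinct strings $x,y\in\{0,1\}^n$, there is a deterministic finite automaton with at most $C\,n^{1/3}\log^7 n$ states that accepts $x$ but does not accept $y$.
   Context: A deterministic finite automaton (DFA) is a 4-tuple $(Q,\delta,q_1,F)$ consisting of a finite set $Q$ (the states), a function $\delta:Q\times\{0,1\}\to Q$, an element $q_1\in Q$ (the initial state), and a subset $F\subseteq Q$ (the accept states). It accepts a string $x=x_1,\dots,x_n\in\{0,1\}^n$ if and only if the sequence defined by $r_1=q_1$ and $r_{i+1}=\delta(r_i,x_i)$ for $1\le i\le n$ satisfies $r_{n+1}\in F$. The number of states is $|Q|$. Here $\log$ is the natural logarithm and $\log^7 n=(\log n)^7$. *)

theory Defs
  imports Complex_Main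
begin

text \<open>The alphabet \<open>{0, 1}\<close> is \<^typ>\<open>bool\<close>, and a string in \<open>{0, 1}\<^sup>n\<close> is a
  \<^typ>\<open>bool list\<close> of length \<open>n\<close>. The transition function is a total function on the type of
  states; only its values on \<open>states M\<close> matter.\<close>

record 'q dfa =
  states :: "'q set"
  trans :: "'q \<Rightarrow> bool \<Rightarrow> 'q"
  init :: 'q
  accepting :: "'q set"

definition is_dfa :: "'q dfa \<Rightarrow> bool" where
  "is_dfa M \<longleftrightarrow>
     finite (states M) \<and>
     (\<forall>q\<in>states M. \<forall>a. trans M q a \<in> states M) \<and>
     init M \<in> states M \<and>
     accepting M \<subseteq> states M"

text \<open>Indices start at 0: \<open>state_seq M x i\<close> is the state after reading the first \<open>i\<close> letters
  of \<open>x\<close>, and it is meaningful for \<open>i \<le> length x\<close> only.\<close>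

primrec state_seq :: "'q dfa \<Rightarrow> bool list \<Rightarrow> nat \<Rightarrow> 'q" where
  "state_seq M x 0 = init M"
| "state_seq M x (Suc i) = trans M (state_seq M x i) (x ! i)"

definition accepts :: "'q dfa \<Rightarrow> bool list \<Rightarrow> bool" where
  "accepts M x \<longleftrightarrow> state_seq M x (length x) \<in> accepting M"

lemma state_seq_eq_foldl:
  "i \<le> length x \<Longrightarrow> state_seq M x i = foldl (trans M) (init M) (take i x)"
  by (induction i) (simp_all add: take_Suc_conv_app_nth)

lemma accepts_iff_foldl: "accepts M x \<longleftrightarrow> foldl (trans M) (init M) x \<in> accepting M"
  by (simp add: accepts_def state_seq_eq_foldl)

end

theory Submission
  imports Defs "HOL-Complex_Analysis.Complex_Analysis" "HOL-Number_Theory.Cong"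
begin

text \<open>
  Let \<open>L\<close> be a power of two of order \<open>n\<^bsup>1/3\<^esup>\<close>. Around the first difference of \<open>x\<close> and \<open>y\<close> one finds
  a pattern \<open>w\<close> of length \<open>2L + 1\<close> without periods \<open>\<le> L\<close>, whose occurrences in \<open>x\<close> and \<open>y\<close> form
  distinct sets \<open>A\<close> and \<open>B\<close> with gaps larger than \<open>L\<close>. If the power sums of \<open>A\<close> and \<open>B\<close> of some
  degree \<open>m < k\<close> differ, then they differ modulo some \<open>p\<close> of order \<open>k log n\<close>, so that \<open>A\<close> and \<open>B\<close> have
  different numbers of elements in some residue class modulo \<open>p\<close>. An automaton with
  \<open>2pq\<close> states counts them modulo a number \<open>q\<close> of order \<open>log n\<close>.

  The power sums differ for some \<open>m < k\<close> with \<open>k\<close> of order \<open>L (log n)\<^sup>3\<close>. Otherwise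
  \<open>f(z) = \<Sum>\<^sub>A z\<^bsup>a-s\<^esup> - \<Sum>\<^sub>B z\<^bsup>a-s\<^esup>\<close>, where \<open>s\<close> is the least element of the symmetric difference,
  vanishes to order \<open>k\<close> at 1 and is tiny near 1. By the gaps, \<open>f(z) = 1 - e z\<^bsup>d\<^esup> + O(z\<^bsup>L\<^esup>)\<close> up to sign,
  with \<open>e\<close> equal to 0 or 1. Choose a polynomial \<open>h\<close> with \<open>h(0) = 0\<close> that maps the closed disc into the
  open disc, with \<open>h(1)\<close> very close to 1 and \<open>1 - |h(e\<^bsup>it\<^esup>)|\<close> at least of order \<open>|t|\<close>. Then
  \<open>G = f(h) / (1 - e h\<^bsup>d\<^esup>)\<close> is holomorphic, \<open>G(0) = 1\<close>, and \<open>G\<close> is extremely close to 1 on the circle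
  except where \<open>|t|\<close> is at most of order \<open>log n / L\<close>. Applying the maximum principle to the product of
  the rotations of \<open>G\<close> by roots of unity of order about \<open>L\<^sup>2 log n\<close> contradicts the smallness of \<open>f\<close> near 1.
\<close>

section \<open>Small non-divisors\<close>

text \<open>Induction along the identity \<open>1/((m+1) C(n,m+1)) = 1/(m C(n-1,m)) - 1/(m C(n,m))\<close> of the Leibniz triangle.\<close>

lemma mult_binomial_dvd:
  fixes a :: int
  assumes "\<And>j. 1 \<le> j \<Longrightarrow> j \<le> n \<Longrightarrow> int j dvd a" and "1 \<le> m" and "m \<le> n"
  shows "int (m * (n choose m)) dvd a"
  using assms(2,3,1)
proof (induction m arbitrary: n rule: dec_induct)
  case base
  then show ?case by simp
next
  case (step m)
  then obtain n' where n: "n = Suc n'" by (cases n) auto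
  have mn: "m \<le> n'" using step n by simp
  have "int (m * (n choose m)) dvd a" using step n by simp
  moreover have "int (m * (n' choose m)) dvd a" using step n by simp
  ultimately obtain x y where
    x: "a = int (m * (n choose m)) * x" and y: "a = int (m * (n' choose m)) * y"
    by (meson dvdE)
  define c where "c = int (n' choose m)"
  have c: "c > 0" using mn by (simp add: c_def)
  have m: "int m > 0" using step by simp
  have e1: "int (Suc m * (n choose Suc m)) = int n * c"
    unfolding n c_def using Suc_times_binomial_eq[of n' m] by (metis mult.commute of_nat_mult)
  have "(n - m) * (n choose m) = n * (n' choose m)"
    using binomial_absorb_comp[of n m] n by simp
  then have e2: "(int n - int m) * int (n choose m) = int n * c"
    unfolding c_def using mn n by (metis le_SucI of_nat_diff of_nat_mult)
  have "int m * c * ((int n - int m) * y) = (int n - int m) * a"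
    unfolding y c_def by simp
  also have "\<dots> = int m * x * ((int n - int m) * int (n choose m))"
    unfolding x by simp
  also have "\<dots> = int m * c * (int n * x)" unfolding e2 by simp
  finally have "(int n - int m) * y = int n * x" using c m by simp
  then have e3: "int n * c * (y - x) = int m * c * y" by (simp add: algebra_simps)
  have "a = int m * c * y" by (simp add: y c_def)
  then have "a = int n * c * (y - x)" by (simp only: e3)
  then have "a = int (Suc m * (n choose Suc m)) * (y - x)" unfolding e1 .
  then show ?case by simp
qed

text \<open>If every \<open>j\<close> up to \<open>2 * r\<close> divided \<open>a\<close>, then so
  would \<open>r * (2 * r choose r)\<close>, which is at least \<open>4 ^ r / 2\<close> and hence
  too large. This supplies both the residue modulus and the counter modulus without any estimate for
  primes.\<close>

lemma exists_small_nondivisor: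
  fixes a :: int
  assumes "a \<noteq> 0" and "\<bar>a\<bar> < 2 ^ r"
  shows "\<exists>j. 1 \<le> j \<and> j \<le> 2 * r \<and> \<not> int j dvd a"
proof (rule ccontr)
  assume neg: "\<not> ?thesis"
  have r: "r > 0" using assms by (cases r) auto
  have "int (r * (2 * r choose r)) dvd a"
    by (rule mult_binomial_dvd) (use neg r in auto)
  then have "int (r * (2 * r choose r)) \<le> \<bar>a\<bar>"
    using dvd_imp_le_int[OF assms(1)] by (metis abs_of_nat)
  then have "int (r * (2 * r choose r)) < int (2 ^ r)" using assms(2) by simp
  then have "r * (2 * r choose r) < 2 ^ r" by (simp only: of_nat_less_iff)
  then have "real (r * (2 * r choose r)) < real (2 ^ r)" by (simp only: of_nat_less_iff)
  then have lt: "real r * real (2 * r choose r) < 2 ^ r" by simp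
  have "4 ^ r / (2 * real r) \<le> real (2 * r choose r)"
    by (rule central_binomial_lower_bound[OF r])
  then have "4 ^ r / 2 \<le> real r * real (2 * r choose r)" using r by (simp add: field_simps)
  with lt have "(4::real) ^ r < 2 * 2 ^ r" by simp
  moreover have "(4::real) ^ r = 2 ^ r * 2 ^ r" by (simp flip: power_mult_distrib)
  ultimately have "(2::real) ^ r < 2" by simp
  then show False using self_le_power[of "2::real" r] r by linarith
qed

section \<open>Occurrences of a pattern\<close>

definition occ :: "'a list \<Rightarrow> 'a list \<Rightarrow> nat set" where
  "occ w x = {a. a + length w \<le> length x \<and> (\<forall>j<length w. x ! (a + j) = w ! j)}"

lemma occ_subset: "occ w x \<subseteq> {..length x}"
  by (auto simp: occ_def)

lemma finite_occ [simp]: "finite (occ w x)"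
  using finite_subset[OF occ_subset] by blast

text \<open>Suppose each last letter came with a period, \<open>p\<close> and \<open>q\<close>.
  Stepping back from the end by \<open>p\<close> and then \<open>q\<close>, or by \<open>q\<close>
  and then \<open>p\<close>, reaches the same position of \<open>u\<close>, which would have to
  carry both letters. The position exists because \<open>p + q <= 2 * L\<close>.\<close>

lemma extension_without_short_period:
  fixes u :: "bool list"
  assumes u: "length u = 2 * L"
  shows "\<exists>s. \<forall>d. 1 \<le> d \<longrightarrow> d \<le> L \<longrightarrow> (\<exists>j. j + d \<le> 2 * L \<and> (u @ [s]) ! j \<noteq> (u @ [s]) ! (j + d))"
proof (rule ccontr)
  assume "\<not> ?thesis"
  then have *: "\<exists>d. 1 \<le> d \<and> d \<le> L \<and> (\<forall>j. j + d \<le> 2 * L \<longrightarrow> (u @ [s]) ! j = (u @ [s]) ! (j + d))" for s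
    by blast
  obtain p where p: "1 \<le> p" "p \<le> L"
    "\<And>j. j + p \<le> 2 * L \<Longrightarrow> (u @ [False]) ! j = (u @ [False]) ! (j + p)" using *[of False] by auto
  obtain q where q: "1 \<le> q" "q \<le> L"
    "\<And>j. j + q \<le> 2 * L \<Longrightarrow> (u @ [True]) ! j = (u @ [True]) ! (j + q)" using *[of True] by auto
  have "u ! (2 * L - p) = False" using p(3)[of "2 * L - p"] p(1,2) u by (simp add: nth_append)
  moreover have "u ! (2 * L - q) = True" using q(3)[of "2 * L - q"] q(1,2) u by (simp add: nth_append)
  moreover have "u ! (2 * L - p - q) = u ! (2 * L - p)"
    using q(3)[of "2 * L - p - q"] p(1,2) q(1,2) u by (simp add: nth_append)
  moreover have "u ! (2 * L - p - q) = u ! (2 * L - q)"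
    using p(3)[of "2 * L - p - q"] p(1,2) q(1,2) u by (simp add: nth_append)
  ultimately show False by simp
qed

text \<open>Take the \<open>2 * L\<close> letters before the first difference and append a letter
  that avoids short periods. The alphabet is binary, so exactly one of \<open>x\<close> and
  \<open>y\<close> continues with that letter. Two occurrences at distance at most \<open>L\<close>
  would give \<open>w\<close> a short period.\<close>

lemma separated_distinguishing_pattern:
  fixes x y :: "bool list"
  assumes "x \<noteq> y" and len: "length x = length y" and pre: "take (2 * L) x = take (2 * L) y"
  obtains w where "length w = 2 * L + 1" and "occ w x \<noteq> occ w y"
    and "\<And>z a b. a \<in> occ w z \<Longrightarrow> b \<in> occ w z \<Longrightarrow> a < b \<Longrightarrow> a + L < b"
proof -
  define i where "i = (LEAST i. i < length x \<and> x ! i \<noteq> y ! i)"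
  have ex: "\<exists>i. i < length x \<and> x ! i \<noteq> y ! i"
    using assms(1) len nth_equalityI by blast
  have i: "i < length x" "x ! i \<noteq> y ! i" using LeastI_ex[OF ex] by (auto simp: i_def)
  have min: "x ! j = y ! j" if "j < i" for j
    using not_less_Least[of j "\<lambda>i. i < length x \<and> x ! i \<noteq> y ! i"] that i(1) by (auto simp: i_def)
  have "2 * L \<le> i"
    by (metis pre i(2) linorder_not_le nth_take)
  define u where "u = take (2 * L) (drop (i - 2 * L) x)"
  have u: "length u = 2 * L" "\<And>j. j < 2 * L \<Longrightarrow> u ! j = x ! (i - 2 * L + j)"
    using i(1) \<open>2 * L \<le> i\<close> by (auto simp: u_def)
  obtain s where s: "\<And>d. 1 \<le> d \<Longrightarrow> d \<le> L \<Longrightarrow> \<exists>j. j + d \<le> 2 * L \<and> (u @ [s]) ! j \<noteq> (u @ [s]) ! (j + d)"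
    using extension_without_short_period[OF u(1)] by blast
  define w where "w = u @ [s]"
  have iff: "i - 2 * L \<in> occ w z \<longleftrightarrow> z ! i = s" 
    if "length z = length x" "\<And>j. j < i \<Longrightarrow> z ! j = x ! j" for z
  proof -
    have "i - 2 * L \<in> occ w z \<longleftrightarrow> (\<forall>j<Suc (2 * L). z ! (i - 2 * L + j) = (u @ [s]) ! j)"
      using that i(1) \<open>2 * L \<le> i\<close> u by (simp add: occ_def w_def)
    also have "\<dots> \<longleftrightarrow> z ! i = s"
      using that \<open>2 * L \<le> i\<close> u by (auto simp: All_less_Suc nth_append)
    finally show ?thesis .
  qed
  have "i - 2 * L \<in> occ w x \<longleftrightarrow> x ! i = s" "i - 2 * L \<in> occ w y \<longleftrightarrow> y ! i = s"
    using iff[of x] iff[of y] len min by auto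
  then have "i - 2 * L \<in> occ w x \<longleftrightarrow> i - 2 * L \<notin> occ w y" using i(2) by auto
  then have "occ w x \<noteq> occ w y" by blast
  moreover have "a + L < b" if ab: "a \<in> occ w z" "b \<in> occ w z" "a < b" for z a b
  proof (rule ccontr)
    assume "\<not> a + L < b"
    then have "1 \<le> b - a" "b - a \<le> L" using ab(3) by auto
    then obtain j where j: "j + (b - a) \<le> 2 * L" "w ! j \<noteq> w ! (j + (b - a))"
      using s[of "b - a"] unfolding w_def by blast
    have "w ! j = z ! (b + j)" "w ! (j + (b - a)) = z ! (a + (j + (b - a)))"
      using ab(1,2) j(1) u(1) by (auto simp: occ_def w_def)
    then show False using j(2) ab(3) by (simp add: algebra_simps)
  qed
  ultimately show ?thesis using that[of w] u(1) by (simp add: w_def)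
qed

lemma occ_snoc:
  assumes "w \<noteq> []"
  shows "occ w (u @ [s]) = occ w u \<union>
    {a. a + length w = Suc (length u) \<and> (\<forall>j<length w. (u @ [s]) ! (a + j) = w ! j)}"
proof -
  have "(a + length w \<le> Suc (length u)) \<longleftrightarrow> a + length w \<le> length u \<or> a + length w = Suc (length u)" for a
    by auto
  moreover have "(\<forall>j<length w. (u @ [s]) ! (a + j) = w ! j) \<longleftrightarrow> (\<forall>j<length w. u ! (a + j) = w ! j)"
    if "a + length w \<le> length u" for a
    using that by (intro all_cong) (auto simp: nth_append)
  ultimately show ?thesis by (auto simp: occ_def)
qed

section \<open>Counting occurrences in a residue class by a finite automaton\<close>

definition residue_class :: "nat \<Rightarrow> nat \<Rightarrow> nat set \<Rightarrow> nat set" where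
  "residue_class p i A = {a \<in> A. a mod p = i}"

lemma finite_residue_class [simp]: "finite A \<Longrightarrow> finite (residue_class p i A)"
  by (simp add: residue_class_def)

text \<open>
  A state \<open>(r, b, c)\<close> records the number \<open>r\<close> of letters read (modulo \<open>p\<close>) since the last position congruent to
  \<open>i\<close>, whether these letters agree with \<open>w\<close>, and the number of occurrences found modulo \<open>q\<close>. The flag \<open>b\<close> is
  irrelevant when \<open>r = 0\<close>. As \<open>length w \<le> p\<close>, one attempt to match is finished before the next one starts.
\<close>

fun count_step :: "bool list \<Rightarrow> nat \<Rightarrow> nat \<Rightarrow> nat \<times> bool \<times> nat \<Rightarrow> bool \<Rightarrow> nat \<times> bool \<times> nat" where
  "count_step w p q (r, b, c) s =
    (let b' = ((r = 0 \<or> b) \<and> (r < length w \<longrightarrow> w ! r = s))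
     in (Suc r mod p, b', if Suc r = length w \<and> b' then Suc c mod q else c))"

text \<open>Adding \<open>p - i\<close> subtracts \<open>i\<close> modulo \<open>p\<close> within
  the naturals. If \<open>r\<close> exceeds \<open>length u\<close>, the current attempt would have
  begun before the word, so its flag must be false.\<close>

definition count_inv :: "bool list \<Rightarrow> nat \<Rightarrow> nat \<Rightarrow> nat \<Rightarrow> bool list \<Rightarrow> nat \<times> bool \<times> nat \<Rightarrow> bool" where
  "count_inv w p i q u = (\<lambda>(r, b, c).
     r = (length u + (p - i)) mod p \<and>
     c = card (residue_class p i (occ w u)) mod q \<and>
     (r \<noteq> 0 \<longrightarrow> (b \<longleftrightarrow> r \<le> length u \<and> (\<forall>j<min r (length w). u ! (length u - r + j) = w ! j))))"

lemma count_inv_step: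
  assumes w: "w \<noteq> []" "length w \<le> p" and i: "i < p" and inv: "count_inv w p i q u (r, b, c)"
  shows "count_inv w p i q (u @ [s]) (count_step w p q (r, b, c) s)"
proof -
  define l where "l = length w"
  define b' where "b' = ((r = 0 \<or> b) \<and> (r < l \<longrightarrow> w ! r = s))"
  have r: "r = (length u + (p - i)) mod p" and c: "c = card (residue_class p i (occ w u)) mod q"
    and b: "r \<noteq> 0 \<Longrightarrow> b \<longleftrightarrow> r \<le> length u \<and> (\<forall>j<min r l. u ! (length u - r + j) = w ! j)"
    using inv by (auto simp: count_inv_def l_def)
  have rp: "r < p" using r i by simp
  have l: "0 < l" "l \<le> p" using w by (auto simp: l_def)
  have b0: "(r = 0 \<or> b) \<longleftrightarrow> r \<le> length u \<and> (\<forall>j<min r l. u ! (length u - r + j) = w ! j)"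
    using b by (cases "r = 0") auto
  have b': "b' \<longleftrightarrow> r \<le> length u \<and> (\<forall>j<min (Suc r) l. (u @ [s]) ! (length u - r + j) = w ! j)"
  proof (cases "r \<le> length u")
    case True
    have eq: "(\<forall>j<min r l. (u @ [s]) ! (length u - r + j) = w ! j) \<longleftrightarrow>
      (\<forall>j<min r l. u ! (length u - r + j) = w ! j)"
      using True by (intro all_cong) (auto simp: nth_append)
    have "(\<forall>j<min (Suc r) l. (u @ [s]) ! (length u - r + j) = w ! j) \<longleftrightarrow>
       (\<forall>j<min r l. (u @ [s]) ! (length u - r + j) = w ! j) \<and> (r < l \<longrightarrow> w ! r = s)"
    proof (cases "r < l")
      case True
      then have "min (Suc r) l = Suc r" "min r l = r" by auto
      then show ?thesis using True \<open>r \<le> length u\<close> by (auto simp: All_less_Suc nth_append)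
    next
      case False
      then have "min (Suc r) l = l" "min r l = l" by auto
      then show ?thesis using False by auto
    qed
    then show ?thesis unfolding b'_def b0 eq using True by blast
  qed (use b0 b'_def in auto)
  \<comment> \<open>The only start at which the new letter can complete an occurrence. The
    subtraction may truncate, so \<open>hit\<close> carries a guard.\<close>
  define a where "a = Suc (length u) - l"
  define hit where "hit \<longleftrightarrow> l \<le> Suc (length u) \<and> (\<forall>j<l. (u @ [s]) ! (a + j) = w ! j)"
  have occ: "occ w (u @ [s]) = occ w u \<union> (if hit then {a} else {})"
    proof -
    have "{a'. a' + l = Suc (length u) \<and> (\<forall>j<l. (u @ [s]) ! (a' + j) = w ! j)} = (if hit then {a} else {})"
      (is "?H = _")
    proof (rule set_eqI)
      fix a'
      have "a' + l = Suc (length u) \<longleftrightarrow> l \<le> Suc (length u) \<and> a' = a" by (auto simp: a_def)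
      then show "a' \<in> ?H \<longleftrightarrow> a' \<in> (if hit then {a} else {})" unfolding hit_def by auto
    qed
    then show ?thesis unfolding occ_snoc[OF w(1)] l_def by simp
  qed
  have a_notin: "a \<notin> occ w u" if hit
    using that l by (auto simp: occ_def l_def[symmetric] a_def hit_def)
  \<comment> \<open>The new letter has index \<open>a + (l - 1) = length u\<close>, and
    \<open>r\<close> is this index minus \<open>i\<close> modulo \<open>p\<close>.\<close>
  have mod_iff: "a mod p = i \<longleftrightarrow> Suc r = l" if "l \<le> Suc (length u)"
  proof -
    have "a mod p = i \<longleftrightarrow> [a = i] (mod p)" using i by (simp add: cong_def)
    also have "\<dots> \<longleftrightarrow> [a + (l - 1) + (p - i) = i + (l - 1) + (p - i)] (mod p)"
      by (metis cong_add_rcancel_nat)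
    also have "a + (l - 1) + (p - i) = length u + (p - i)"
      using that l by (simp add: a_def)
    also have "i + (l - 1) + (p - i) = p + (l - 1)" using i by simp
    also have "[length u + (p - i) = p + (l - 1)] (mod p) \<longleftrightarrow> r = l - 1"
    proof -
      have "l - 1 < p" using l by simp
      then show ?thesis unfolding r cong_def mod_add_self1 by simp
    qed
    finally show ?thesis using l by auto
  qed
  have hit_iff: "hit \<and> a mod p = i \<longleftrightarrow> Suc r = l \<and> b'"
  proof (cases "Suc r = l")
    case True
    then have "length u - r = a" if "r \<le> length u" using that by (auto simp: a_def)
    then have "hit \<longleftrightarrow> b'" unfolding hit_def b' using True by auto
    then show ?thesis using True mod_iff hit_def by blast
  next
    case False
    then show ?thesis using mod_iff hit_def by blast
  qed
  have cls: "residue_class p i (occ w (u @ [s])) =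
      residue_class p i (occ w u) \<union> (if Suc r = l \<and> b' then {a} else {})"
    unfolding occ residue_class_def using hit_iff by auto
  have card: "card (residue_class p i (occ w (u @ [s]))) =
      card (residue_class p i (occ w u)) + (if Suc r = l \<and> b' then 1 else 0)"
  proof (cases "Suc r = l \<and> b'")
    case True
    then have "a \<notin> residue_class p i (occ w u)" using a_notin hit_iff by (auto simp: residue_class_def)
    then show ?thesis using True unfolding cls by simp
  next
    case False
    then show ?thesis unfolding cls if_not_P[OF False] by simp
  qed
  have r': "Suc r mod p = (length (u @ [s]) + (p - i)) mod p"
    unfolding r by (simp add: mod_Suc_eq)
  \<comment> \<open>When the phase wraps to 0, the clause about the flag is vacuous.\<close>
  have "Suc r mod p \<noteq> 0 \<longrightarrow> Suc r mod p = Suc r" using rp by (metis Suc_lessI mod_less mod_self)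
  then have "Suc r mod p \<noteq> 0 \<longrightarrow> (b' \<longleftrightarrow> Suc r mod p \<le> length (u @ [s]) \<and>
      (\<forall>j<min (Suc r mod p) l. (u @ [s]) ! (length (u @ [s]) - Suc r mod p + j) = w ! j))"
    unfolding b' by auto
  then show ?thesis
    unfolding count_inv_def count_step.simps Let_def l_def[symmetric] b'_def[symmetric] prod.case
    using r' card c by (auto simp: mod_Suc_eq)
qed

lemma count_inv_foldl:
  assumes "w \<noteq> []" "length w \<le> p" "i < p"
  shows "count_inv w p i q u (foldl (count_step w p q) ((p - i) mod p, False, 0) u)"
proof (induction u rule: rev_induct)
  case Nil
  have "occ w [] = {}" using assms by (auto simp: occ_def)
  then show ?case using assms by (auto simp: count_inv_def residue_class_def)
next
  case (snoc s u)
  then show ?case using count_inv_step[OF assms] by (metis foldl_Cons foldl_Nil foldl_append prod_cases3)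
qed

text \<open>The prefix \<open>z\<close> costs no states, being absorbed into the initial state.
  Acceptance compares the counter with its value on \<open>x\<close>, and \<open>to_nat\<close>
  codes the triples as numbers.\<close>

lemma residue_count_dfa:
  fixes x y z w :: "bool list"
  assumes w: "w \<noteq> []" "length w \<le> p" and i: "i < p" and q: "q > 0"
    and ne: "card (residue_class p i (occ w (z @ x))) mod q \<noteq> card (residue_class p i (occ w (z @ y))) mod q"
  shows "\<exists>M::nat dfa. is_dfa M \<and> card (states M) \<le> 2 * p * q \<and> accepts M x \<and> \<not> accepts M y"
proof -
  define S where "S = {..<p} \<times> (UNIV :: bool set) \<times> {..<q}"
  define st where "st = count_step w p q"
  define s0 where "s0 = ((p - i) mod p, False, 0::nat)"
  define c where "c = card (residue_class p i (occ w (z @ x))) mod q"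
  define M where "M = \<lparr>states = to_nat ` S, trans = (\<lambda>k s. to_nat (st (from_nat k) s)),
     init = to_nat (foldl st s0 z), accepting = to_nat ` {t \<in> S. snd (snd t) = c}\<rparr>"
  have step: "st t s \<in> S" if "t \<in> S" for t s
    using that i q by (cases t) (auto simp: S_def st_def Let_def)
  have run: "foldl st t u \<in> S" if "t \<in> S" for t u
    using that step by (induction u arbitrary: t) auto
  have s0: "s0 \<in> S" using i q by (auto simp: S_def s0_def)
  have fold: "foldl (trans M) (to_nat t) u = to_nat (foldl st t u)" for t u
    by (induction u arbitrary: t) (auto simp: M_def)
  have run_M: "foldl (trans M) (init M) u = to_nat (foldl st s0 (z @ u))" for u
    using fold[of "foldl st s0 z" u] by (simp add: M_def)
  have counter: "snd (snd (foldl st s0 u)) = card (residue_class p i (occ w u)) mod q" for u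
    using count_inv_foldl[OF w i, of q u]
    by (cases "foldl st s0 u") (simp add: count_inv_def st_def s0_def)
  have acc: "accepts M u \<longleftrightarrow> card (residue_class p i (occ w (z @ u))) mod q = c" for u
  proof -
    have "foldl st s0 (z @ u) \<in> S" by (rule run[OF s0])
    then show ?thesis
      unfolding accepts_iff_foldl run_M counter[symmetric] by (auto simp: M_def)
  qed
  have "card (states M) = card S"
    by (auto simp: M_def intro!: card_image inj_onI)
  also have "\<dots> = 2 * p * q" by (simp add: S_def card_cartesian_product)
  finally have "card (states M) \<le> 2 * p * q" by simp
  moreover have "is_dfa M"
    using step run[OF s0] by (auto simp: is_dfa_def M_def S_def)
  ultimately show ?thesis using acc ne c_def by metis
qed

section \<open>A polynomial touching the unit circle at 1\<close>

text \<open>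
  Explicitly \<open>dyadic_avg M z = (\<Sum>i<M. z\<^bsup>2^i\<^esup> / 2\<^bsup>i+1\<^esup>) + z\<^bsup>2^M\<^esup> / 2\<^bsup>M\<^esup>\<close>. On the circle, the two consecutive terms with
  \<open>2\<^sup>i |t|\<close> between \<open>\<pi>/2\<close> and \<open>\<pi>\<close> cancel partially, which gives \<open>1 - |dyadic_avg M (cis t)| \<ge> c |t|\<close>.
\<close>

primrec dyadic_avg :: "nat \<Rightarrow> complex \<Rightarrow> complex" where
  "dyadic_avg 0 z = z"
| "dyadic_avg (Suc M) z = (z + dyadic_avg M (z\<^sup>2)) / 2"

lemma dyadic_avg_0 [simp]: "dyadic_avg M 0 = 0"
  by (induction M) auto

lemma holomorphic_on_dyadic_avg: "f holomorphic_on S \<Longrightarrow> (\<lambda>z. dyadic_avg M (f z)) holomorphic_on S"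
proof (induction M arbitrary: f)
  case (Suc M)
  have "(\<lambda>z. dyadic_avg M ((f z)\<^sup>2)) holomorphic_on S"
    by (rule Suc.IH) (intro holomorphic_intros Suc.prems)
  then show ?case using Suc.prems by (simp add: holomorphic_on_add holomorphic_on_divide)
qed simp

lemma norm_dyadic_avg_le_1: "norm z \<le> 1 \<Longrightarrow> norm (dyadic_avg M z) \<le> 1"
proof (induction M arbitrary: z)
  case (Suc M)
  then have "norm (dyadic_avg M (z\<^sup>2)) \<le> 1" by (simp add: norm_power power_le_one)
  then show ?case using norm_triangle_ineq[of z "dyadic_avg M (z\<^sup>2)"] Suc.prems by (simp add: norm_divide)
qed auto

text \<open>Squaring at most doubles the distance to 1 and averaging halves it again, so each level
  adds only half of \<open>norm (z - 1)\<close>.\<close>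

lemma norm_dyadic_avg_diff_1_le: "norm z \<le> 1 \<Longrightarrow> norm (dyadic_avg M z - 1) \<le> (real M + 1) * norm (z - 1)"
proof (induction M arbitrary: z)
  case (Suc M)
  have "norm (dyadic_avg M (z\<^sup>2) - 1) \<le> (real M + 1) * norm (z\<^sup>2 - 1)"
    using Suc by (simp add: norm_power power_le_one)
  also have "\<dots> \<le> (real M + 1) * (2 * norm (z - 1))"
    using norm_power_diff[of z 1 2] Suc.prems by (intro mult_left_mono) auto
  finally have "norm (dyadic_avg M (z\<^sup>2) - 1) \<le> (real M + 1) * (2 * norm (z - 1))" .
  moreover have "dyadic_avg (Suc M) z - 1 = ((z - 1) + (dyadic_avg M (z\<^sup>2) - 1)) / 2"
    by (simp add: field_simps)
  then have "norm (dyadic_avg (Suc M) z - 1) \<le> (norm (z - 1) + norm (dyadic_avg M (z\<^sup>2) - 1)) / 2"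
    using norm_triangle_ineq[of "z - 1" "dyadic_avg M (z\<^sup>2) - 1"] by (simp only: norm_divide) simp
  ultimately have "norm (dyadic_avg (Suc M) z - 1) \<le> (norm (z - 1) + (real M + 1) * (2 * norm (z - 1))) / 2"
    by simp
  also have "\<dots> \<le> (real (Suc M) + 1) * norm (z - 1)" by (simp add: field_simps)
  finally show ?case .
qed auto

text \<open>In the left half plane the first two terms cannot align. For \<open>M >= 1\<close>,
  \<open>z / 2 + z^2 / 4\<close> has norm at most \<open>sqrt (5 / 4) / 2 <= 9 / 16\<close>, and the
  remaining terms have total weight 1/4.\<close>

lemma norm_dyadic_avg_le_of_Re_nonpos:
  assumes z: "norm z = 1" "Re z \<le> 0"
  shows "norm (dyadic_avg (Suc M) z) \<le> 13 / 16"
proof -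
  have sq: "norm (1 + of_real a * z) \<le> sqrt (1 + a\<^sup>2)" if "a \<ge> 0" for a :: real
  proof -
    have "(Re z)\<^sup>2 + (Im z)\<^sup>2 = 1" using z(1) by (simp flip: cmod_power2)
    then have "a\<^sup>2 * (Re z)\<^sup>2 + a\<^sup>2 * (Im z)\<^sup>2 = a\<^sup>2" by (metis distrib_left mult.right_neutral)
    then have "(1 + a * Re z)\<^sup>2 + (a * Im z)\<^sup>2 = 1 + a\<^sup>2 + 2 * (a * Re z)"
      by (simp add: power2_sum power_mult_distrib)
    then show ?thesis using that z(2) by (simp add: cmod_def mult_nonneg_nonpos)
  qed
  show ?thesis
  proof (cases M)
    case 0
    have "norm (dyadic_avg (Suc M) z) = norm z * norm (1 + z) / 2"
      unfolding norm_mult[symmetric] 0 by (simp add: norm_divide power2_eq_square algebra_simps)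
    also have "\<dots> \<le> sqrt 2 / 2" using sq[of 1] z(1) by simp
    also have "\<dots> \<le> 13 / 16" using real_le_lsqrt[of "13 / 8" 2] by (simp add: power2_eq_square)
    finally show ?thesis .
  next
    case (Suc M')
    have "dyadic_avg (Suc M) z = (z * (1 + of_real (1/2) * z) + dyadic_avg M' ((z\<^sup>2)\<^sup>2) / 2) / 2"
      unfolding Suc by (simp add: field_simps power2_eq_square)
    then have "norm (dyadic_avg (Suc M) z) \<le> (norm (z * (1 + of_real (1/2) * z)) + norm (dyadic_avg M' ((z\<^sup>2)\<^sup>2)) / 2) / 2"
      using norm_triangle_ineq[of "z * (1 + of_real (1/2) * z)" "dyadic_avg M' ((z\<^sup>2)\<^sup>2) / 2"]
      by (simp only: norm_divide) simp
    also have "norm (dyadic_avg M' ((z\<^sup>2)\<^sup>2)) \<le> 1" by (rule norm_dyadic_avg_le_1) (simp add: norm_power z(1))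
    also have "norm (z * (1 + of_real (1/2) * z)) \<le> sqrt (5 / 4)"
      using sq[of "1/2"] z(1) by (simp add: norm_mult power2_eq_square)
    also have "sqrt (5 / 4) \<le> 9 / 8" by (rule real_le_lsqrt) (auto simp: power2_eq_square)
    finally show ?thesis by simp
  qed
qed

text \<open>Passing to \<open>2 * t\<close> doubles the deficit \<open>|t| / 20\<close>, and
  averaging with a unit vector halves it again. The doubling ends once \<open>|t| >= pi / 2\<close>,
  where 13/16 suffices because \<open>pi / 20 < 3 / 16\<close>.\<close>

lemma norm_dyadic_avg_cis_le:
  "pi / 2 ^ M \<le> \<bar>t\<bar> \<Longrightarrow> \<bar>t\<bar> \<le> pi \<Longrightarrow> M \<ge> 1 \<Longrightarrow> norm (dyadic_avg M (cis t)) \<le> 1 - \<bar>t\<bar> / 20"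
proof (induction M arbitrary: t)
  case (Suc M)
  show ?case
  proof (cases "\<bar>t\<bar> \<ge> pi / 2")
    case True
    have "cos \<bar>t\<bar> \<le> 0"
      using cos_monotone_0_pi_le[of "pi/2" "\<bar>t\<bar>"] True Suc.prems by simp
    then have "norm (dyadic_avg (Suc M) (cis t)) \<le> 13 / 16"
      by (intro norm_dyadic_avg_le_of_Re_nonpos) auto
    moreover have "pi < 3.75" using pi_approx by simp
    ultimately show ?thesis using Suc.prems by simp
  next
    case False
    have "M \<ge> 1"
    proof (rule ccontr)
      assume "\<not> M \<ge> 1" then have "M = 0" by simp
      then show False using False Suc.prems(1) by simp
    qed
    have "norm (dyadic_avg M (cis (2 * t))) \<le> 1 - \<bar>2 * t\<bar> / 20"
      using Suc.prems(1) False \<open>M \<ge> 1\<close> by (intro Suc.IH) (auto simp: field_simps abs_mult)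
    moreover have "norm (dyadic_avg (Suc M) (cis t)) \<le> (1 + norm (dyadic_avg M (cis (2 * t)))) / 2"
      using norm_triangle_ineq[of "cis t" "dyadic_avg M ((cis t)\<^sup>2)"]
      by (simp add: norm_divide power2_eq_square cis_mult)
    ultimately show ?thesis by simp
  qed
qed simp

section \<open>Vanishing power sums\<close>

lemma gbinomial_moments_vanish:
  fixes c :: "nat \<Rightarrow> real" and x :: "nat \<Rightarrow> real"
  assumes "\<And>m. m < k \<Longrightarrow> (\<Sum>a\<in>S. c a * x a ^ m) = 0" and "i < k"
  shows "(\<Sum>a\<in>S. c a * ((x a - s) gchoose i)) = 0"
proof -
  \<comment> \<open>The spare power \<open>x a ^ m\<close> strengthens the claim so that the factors
    of the falling factorial can be multiplied in one at a time.\<close>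
  have "(\<Sum>a\<in>S. c a * (\<Prod>t<i. x a - s - real t) * x a ^ m) = 0" if "i + m < k" for m
    using that
  proof (induction i arbitrary: m)
    case 0
    then show ?case using assms(1) by simp
  next
    case (Suc i)
    have "(\<Sum>a\<in>S. c a * (\<Prod>t<Suc i. x a - s - real t) * x a ^ m) =
      (\<Sum>a\<in>S. c a * (\<Prod>t<i. x a - s - real t) * x a ^ Suc m) -
      (s + real i) * (\<Sum>a\<in>S. c a * (\<Prod>t<i. x a - s - real t) * x a ^ m)"
      unfolding sum_distrib_left sum_subtractf[symmetric] by (intro sum.cong) (auto simp: algebra_simps)
    also have "\<dots> = 0" using Suc.IH[of "Suc m"] Suc.IH[of m] Suc.prems by simp
    finally show ?case .
  qed
  from this[of 0] have "(\<Sum>a\<in>S. c a * (\<Prod>t<i. x a - s - real t)) / fact i = 0" using assms(2) by simp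
  then show ?thesis unfolding sum_divide_distrib
    by (simp add: gbinomial_prod_rev atLeast0LessThan)
qed

text \<open>In the expansion around 1 the coefficients of degree below \<open>k\<close> vanish. In
  the others, inserting the factor \<open>2 ^ i / 2 ^ k >= 1\<close> and summing by the binomial
  theorem gives the bound.\<close>

lemma norm_le_of_vanishing_moments:
  fixes c :: "nat \<Rightarrow> real" and z :: complex
  assumes S: "finite S" "\<And>a. a \<in> S \<Longrightarrow> s \<le> a \<and> a \<le> N" and c: "\<And>a. a \<in> S \<Longrightarrow> \<bar>c a\<bar> \<le> 1"
    and van: "\<And>m. m < k \<Longrightarrow> (\<Sum>a\<in>S. c a * real a ^ m) = 0"
  shows "norm (\<Sum>a\<in>S. of_real (c a) * z ^ (a - s)) \<le> real (card S) * (1 + 2 * norm (z - 1)) ^ N / 2 ^ k"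
proof -
  let ?g = "\<lambda>a i. of_nat ((a - s) choose i) * (z - 1) ^ i"
  have exp: "z ^ (a - s) = (\<Sum>i\<le>N. ?g a i)" if "a \<in> S" for a
  proof -
    have "z ^ (a - s) = (\<Sum>i\<le>a - s. ?g a i)"
      using binomial_ring[of "z - 1" 1 "a - s"] by simp
    also have "\<dots> = (\<Sum>i\<le>N. ?g a i)"
      by (rule sum.mono_neutral_left) (use S(2)[OF that] in auto)
    finally show ?thesis .
  qed
  have b: "(\<Sum>a\<in>S. of_real (c a) * (of_nat ((a - s) choose i) :: complex)) = 0" if "i < k" for i
  proof -
    have "(\<Sum>a\<in>S. c a * real ((a - s) choose i)) = (\<Sum>a\<in>S. c a * ((real a - real s) gchoose i))"
      using S(2) by (intro sum.cong) (auto simp: binomial_gbinomial of_nat_diff)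
    also have "\<dots> = 0" using gbinomial_moments_vanish[OF van that] by simp
    finally have "complex_of_real (\<Sum>a\<in>S. c a * real ((a - s) choose i)) = 0" by simp
    then show ?thesis by simp
  qed
  have "(\<Sum>a\<in>S. of_real (c a) * z ^ (a - s)) = (\<Sum>a\<in>S. \<Sum>i\<le>N. of_real (c a) * ?g a i)"
    using exp by (simp add: sum_distrib_left)
  also have "\<dots> = (\<Sum>i\<le>N. \<Sum>a\<in>S. of_real (c a) * ?g a i)" by (rule sum.swap)
  also have "\<dots> = (\<Sum>i\<le>N. (z - 1) ^ i * (\<Sum>a\<in>S. of_real (c a) * of_nat ((a - s) choose i)))"
    by (simp add: sum_distrib_left mult_ac)
  also have "\<dots> = (\<Sum>i\<in>{k..N}. (z - 1) ^ i * (\<Sum>a\<in>S. of_real (c a) * of_nat ((a - s) choose i)))"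
    by (rule sum.mono_neutral_right) (use b in auto)
  also have "\<dots> = (\<Sum>i\<in>{k..N}. \<Sum>a\<in>S. of_real (c a) * ?g a i)"
    by (simp add: sum_distrib_left mult_ac)
  also have "\<dots> = (\<Sum>a\<in>S. \<Sum>i\<in>{k..N}. of_real (c a) * ?g a i)" by (rule sum.swap)
  also have "norm \<dots> \<le> (\<Sum>a\<in>S. (1 + 2 * norm (z - 1)) ^ N / 2 ^ k)"
  proof (rule sum_norm_le)
    fix a assume a: "a \<in> S"
    have "norm (\<Sum>i\<in>{k..N}. of_real (c a) * ?g a i) \<le>
      (\<Sum>i\<in>{k..N}. real (N choose i) * (2 * norm (z - 1)) ^ i / 2 ^ k)"
    proof (rule sum_norm_le)
      fix i assume i: "i \<in> {k..N}"
      have "norm (of_real (c a) * ?g a i) = \<bar>c a\<bar> * (real ((a - s) choose i) * norm (z - 1) ^ i)"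
        by (simp add: norm_mult norm_power)
      also have "\<dots> \<le> 1 * (real (N choose i) * norm (z - 1) ^ i)"
        using c[OF a] S(2)[OF a] by (intro mult_mono of_nat_mono binomial_right_mono) auto
      also have "\<dots> \<le> real (N choose i) * norm (z - 1) ^ i * (2 ^ i / 2 ^ k)"
      proof -
        have "1 \<le> (2::real) ^ i / 2 ^ k" using i by (simp add: power_increasing)
        then show ?thesis
          using mult_left_mono[of 1 "2 ^ i / 2 ^ k" "real (N choose i) * norm (z - 1) ^ i"] by simp
      qed
      finally show "norm (of_real (c a) * ?g a i) \<le> real (N choose i) * (2 * norm (z - 1)) ^ i / 2 ^ k"
        by (simp add: power_mult_distrib mult_ac)
    qed
    also have "\<dots> \<le> (\<Sum>i\<in>{..N}. real (N choose i) * (2 * norm (z - 1)) ^ i / 2 ^ k)"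
      by (rule sum_mono2) auto
    also have "\<dots> = (2 * norm (z - 1) + 1) ^ N / 2 ^ k"
      by (simp add: binomial_ring sum_divide_distrib)
    finally show "norm (\<Sum>i\<in>{k..N}. of_real (c a) * ?g a i) \<le> (1 + 2 * norm (z - 1)) ^ N / 2 ^ k"
      by (simp add: add.commute)
  qed
  finally show ?thesis by simp
qed

section \<open>The maximum principle for products of rotations\<close>

lemma prod_shift_periodic:
  fixes F :: "int \<Rightarrow> 'a :: comm_monoid_mult"
  assumes "\<And>j. F (j + (b - a) + 1) = F j" and ab: "a \<le> b"
  shows "(\<Prod>j\<in>{a..b}. F (j + s)) = (\<Prod>j\<in>{a..b}. F j)"
proof -
  have step: "(\<Prod>j\<in>{a..b}. F (j + (s + 1))) = (\<Prod>j\<in>{a..b}. F (j + s))" for s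
  proof -
    have "(\<Prod>j\<in>{a..b}. F (j + (s + 1))) = (\<Prod>j\<in>{a + 1..b + 1}. F (j + s))"
      by (rule prod.reindex_bij_witness[of _ "\<lambda>j. j - 1" "\<lambda>j. j + 1"]) (auto simp: algebra_simps)
    also have "{a + 1..b + 1} = insert (b + 1) {a + 1..b}" using ab by auto
    also have "(\<Prod>j\<in>insert (b + 1) {a + 1..b}. F (j + s)) = F (b + 1 + s) * (\<Prod>j\<in>{a + 1..b}. F (j + s))"
      by simp
    also have "F (b + 1 + s) = F (a + s)" using assms(1)[of "a + s"] by (simp add: algebra_simps)
    also have "F (a + s) * (\<Prod>j\<in>{a + 1..b}. F (j + s)) = (\<Prod>j\<in>insert a {a + 1..b}. F (j + s))" by simp
    also have "insert a {a + 1..b} = {a..b}" using ab by auto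
    finally show ?thesis .
  qed
  show ?thesis
  proof (induction s rule: int_induct[of _ 0])
    case base
    then show ?case by simp
  next
    case (step1 i)
    then show ?case using step[of i] by (simp only:)
  next
    case (step2 i)
    then show ?case using step[of "i - 1"] by (simp only: diff_add_cancel)
  qed
qed

text \<open>The product of the rotated functions is 1 at 0, so by the maximum principle its modulus
  is at least 1 somewhere on the circle. Rotating that point by a multiple of
  \<open>2 * pi / m\<close> only permutes the factors, so its angle can be brought within
  \<open>pi / m\<close> of 0.\<close>

lemma prod_rotations_ge_1:
  fixes G :: "complex \<Rightarrow> complex" and K :: nat and m :: real
  assumes G: "G holomorphic_on ball 0 1" "continuous_on (cball 0 1) G" "G 0 = 1"
  defines "m \<equiv> real (2 * K + 1)"
  shows "\<exists>\<theta>. \<bar>\<theta>\<bar> \<le> pi / m \<and> 1 \<le> (\<Prod>j\<in>{-int K..int K}. norm (G (cis (\<theta> + 2 * pi * of_int j / m))))"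
proof -
  define P where "P z = (\<Prod>j\<in>{-int K..int K}. G (cis (2 * pi * of_int j / m) * z))" for z
  have m: "m > 0" by (simp add: m_def)
  have hol: "P holomorphic_on ball 0 1"
    unfolding P_def
    by (intro holomorphic_intros holomorphic_on_compose_gen[OF _ G(1), unfolded o_def])
       (auto simp: norm_mult)
  have cont: "continuous_on (cball 0 1) P"
    unfolding P_def
    by (intro continuous_intros continuous_on_compose2[OF G(2)]) (auto simp: norm_mult)
  have "\<exists>z\<in>sphere 0 1. 1 \<le> norm (P z)"
  proof (rule ccontr)
    assume neg: "\<not> ?thesis"
    have "\<exists>z0\<in>sphere 0 1. \<forall>z\<in>sphere 0 1. norm (P z) \<le> norm (P (z0::complex))"
      by (rule continuous_attains_sup)
         (auto intro!: continuous_intros continuous_on_subset[OF cont])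
    then obtain z0 where z0: "z0 \<in> sphere 0 1" "\<And>z. z \<in> sphere 0 1 \<Longrightarrow> norm (P z) \<le> norm (P z0)" by blast
    have "norm (P 0) \<le> norm (P z0)"
      by (rule maximum_modulus_frontier[of P "cball 0 1"]) (use hol cont z0 in auto)
    moreover have "P 0 = 1" by (simp add: P_def G(3))
    ultimately show False using neg z0(1) by auto
  qed
  then obtain z where z: "norm z = 1" "1 \<le> norm (P z)" by auto
  obtain \<phi> where \<phi>: "z = cis \<phi>"
    using z(1) rcis_cmod_Arg[of z] that[of "Arg z"] by (simp add: rcis_def)
  define F where "F j = norm (G (cis (\<phi> + 2 * pi * of_int j / m)))" for j :: int
  have per: "F (j + (int K - (- int K)) + 1) = F j" for j
  proof -
    have "\<phi> + 2 * pi * of_int (j + (int K - (- int K)) + 1) / m = \<phi> + 2 * pi * of_int j / m + 2 * pi"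
      using m by (simp add: m_def field_simps)
    then have "cis (\<phi> + 2 * pi * of_int (j + (int K - (- int K)) + 1) / m) = cis (\<phi> + 2 * pi * of_int j / m)"
      by (simp flip: cis_mult)
    then show ?thesis unfolding F_def by simp
  qed
  define s where "s = round (- \<phi> * m / (2 * pi))"
  define \<theta> where "\<theta> = \<phi> + 2 * pi * of_int s / m"
  have "\<bar>of_int s - (- \<phi> * m / (2 * pi))\<bar> \<le> 1 / 2"
    unfolding s_def by (rule of_int_round_abs_le)
  then have "\<bar>\<theta>\<bar> \<le> pi / m"
    unfolding \<theta>_def using m by (simp add: abs_le_iff field_simps)
  moreover have "1 \<le> (\<Prod>j\<in>{-int K..int K}. norm (G (cis (\<theta> + 2 * pi * of_int j / m))))"
  proof -
    have "1 \<le> (\<Prod>j\<in>{-int K..int K}. F j)"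
      using z(2) by (simp add: P_def F_def \<phi> cis_mult add.commute flip: prod_norm)
    also have "\<dots> = (\<Prod>j\<in>{-int K..int K}. F (j + s))"
      using prod_shift_periodic[of F "int K" "- int K" s] per by simp
    also have "\<dots> = (\<Prod>j\<in>{-int K..int K}. norm (G (cis (\<theta> + 2 * pi * of_int j / m))))"
      unfolding F_def \<theta>_def by (simp add: add_divide_distrib algebra_simps)
    finally show ?thesis .
  qed
  ultimately show ?thesis by blast
qed

section \<open>Power sums of separated sets\<close>

lemma norm_one_minus_power_ge:
  fixes w :: complex
  assumes "0 \<le> e" "e \<le> 1" "1 \<le> d" "norm w \<le> 1 - u" "0 \<le> u"
  shows "u \<le> norm (1 - of_real e * w ^ d)"
proof -
  have "norm w ^ d \<le> norm w ^ 1" using assms by (intro power_decreasing) auto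
  then have "e * norm w ^ d \<le> 1 * norm w" using assms by (intro mult_mono) auto
  then have "norm (of_real e * w ^ d) \<le> 1 - u" using assms by (simp add: norm_mult norm_power)
  then show ?thesis using norm_triangle_ineq2[of 1 "of_real e * w ^ d"] by simp
qed

lemma norm_power_tail_le:
  fixes w :: complex and c :: "nat \<Rightarrow> real"
  assumes c: "\<And>j. \<bar>c j\<bar> \<le> 1" and w: "norm w \<le> 1 - u" and u: "0 < u" "u \<le> 1"
  shows "norm (\<Sum>j\<in>{L<..N}. of_real (c j) * w ^ j) \<le> (1 - u) ^ L / u"
proof -
  have "norm (\<Sum>j\<in>{L<..N}. of_real (c j) * w ^ j) \<le> (\<Sum>j\<in>{L<..N}. (1 - u) ^ j)"
  proof (rule sum_norm_le)
    fix j
    have "\<bar>c j\<bar> * norm w ^ j \<le> 1 * (1 - u) ^ j"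
      using c w u by (intro mult_mono power_mono) auto
    then show "norm (of_real (c j) * w ^ j) \<le> (1 - u) ^ j" by (simp add: norm_mult norm_power)
  qed
  also have "\<dots> \<le> (\<Sum>j\<in>{L..<L + Suc N}. (1 - u) ^ j)"
    using u by (intro sum_mono2) auto
  also have "\<dots> = (\<Sum>j<Suc N. (1 - u) ^ (j + L))"
    using sum.shift_bounds_nat_ivl[of "\<lambda>j. (1 - u) ^ j" 0 L "Suc N"] by (simp add: add.commute atLeast0LessThan)
  also have "\<dots> = (1 - u) ^ L * (\<Sum>j<Suc N. (1 - u) ^ j)"
    by (simp only: power_add sum_distrib_left mult.commute)
  also have "(\<Sum>j<Suc N. (1 - u) ^ j) = (1 - (1 - u) ^ Suc N) / u"
    using u by (subst sum_gp_strict) auto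
  also have "(1 - u) ^ L * \<dots> \<le> (1 - u) ^ L * (1 / u)"
    using u by (intro mult_left_mono divide_right_mono) (auto simp: zero_le_mult_iff)
  finally show ?thesis by simp
qed

text \<open>Index 0 contributes a tiny factor, the fewer than \<open>2 * J\<close> other near
  indices a crude one, and the far ones a factor close to 1. As \<open>B2 >= 1\<close>, it may be
  charged to every index.\<close>

lemma prod_three_scales_le:
  fixes b :: "int \<Rightarrow> real"
  assumes b: "\<And>j. j \<in> {-int K..int K} \<Longrightarrow> 0 \<le> b j" and "b 0 \<le> B0" and "0 \<le> B0" and B1: "1 \<le> B1"
    and mid: "\<And>j. j \<in> {-int K..int K} \<Longrightarrow> j \<noteq> 0 \<Longrightarrow> b j \<le> B1"
    and far: "\<And>j. j \<in> {-int K..int K} \<Longrightarrow> int J \<le> \<bar>j\<bar> \<Longrightarrow> b j \<le> B2" and B2: "1 \<le> B2" and J: "1 \<le> J"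
  shows "(\<Prod>j\<in>{-int K..int K}. b j) \<le> B0 * B1 ^ (2 * J) * B2 ^ (2 * K + 1)"
proof -
  let ?R = "{-int K..int K}"
  have "(\<Prod>j\<in>?R. b j) \<le> (\<Prod>j\<in>?R. (if j = 0 then B0 else 1) * (if \<bar>j\<bar> < int J then B1 else 1) * B2)"
  proof (rule prod_mono, intro conjI)
    fix j assume j: "j \<in> ?R"
    show "0 \<le> b j" by (rule b[OF j])
    consider "j = 0" | "j \<noteq> 0" "\<bar>j\<bar> < int J" | "j \<noteq> 0" "int J \<le> \<bar>j\<bar>" by linarith
    then show "b j \<le> (if j = 0 then B0 else 1) * (if \<bar>j\<bar> < int J then B1 else 1) * B2"
    proof cases
      case 1
      have "B0 * 1 \<le> B0 * (B1 * B2)"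
        using B1 B2 assms(3) mult_mono[of 1 B1 1 B2] by (intro mult_left_mono) auto
      then show ?thesis using 1 J assms(2) by (simp add: mult.assoc)
    next
      case 2
      have "B1 * 1 \<le> B1 * B2" using B1 B2 by (intro mult_left_mono) auto
      then show ?thesis using 2 mid[OF j] by simp
    next
      case 3
      then show ?thesis using far[OF j] by simp
    qed
  qed
  also have "\<dots> = (\<Prod>j\<in>?R. if j = 0 then B0 else 1) * (\<Prod>j\<in>?R. if \<bar>j\<bar> < int J then B1 else 1) * B2 ^ (2 * K + 1)"
  proof -
    have "card ?R = 2 * K + 1" by simp
    then show ?thesis by (simp only: prod.distrib prod_constant)
  qed
  also have "(\<Prod>j\<in>?R. if j = 0 then B0 else 1) = B0" by simp
  also have "(\<Prod>j\<in>?R. if \<bar>j\<bar> < int J then B1 else 1) = B1 ^ card {j \<in> ?R. \<bar>j\<bar> < int J}"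
    by (subst prod.inter_filter[symmetric]) auto
  also have "B0 * \<dots> * B2 ^ (2 * K + 1) \<le> B0 * B1 ^ (2 * J) * B2 ^ (2 * K + 1)"
  proof -
    have "card {j \<in> ?R. \<bar>j\<bar> < int J} \<le> card {- int J + 1..int J - 1}"
      by (rule card_mono) auto
    also have "\<dots> \<le> 2 * J" using J by simp
    finally show ?thesis
      using B1 B2 assms(3) by (intro mult_right_mono mult_left_mono power_increasing) auto
  qed
  finally show ?thesis .
qed

text \<open>The product of the rotations of \<open>G\<close> is at least 1. The factor nearest to 1
  is at most \<open>4 ^ l * E\<close>, the near ones are at most \<open>64 ^ l\<close> each, and the
  far ones contribute at most \<open>(1 + 1 / m) ^ m <= 3\<close>, where \<open>m\<close> is the
  number of rotations.\<close>

lemma gapped_polynomial_lower_bound: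
  fixes c :: "nat \<Rightarrow> real" and e :: real and f :: "complex \<Rightarrow> complex" and d l N J :: nat
  defines "f \<equiv> \<lambda>z. 1 - of_real e * z ^ d + (\<Sum>j\<in>{2 ^ l<..N}. of_real (c j) * z ^ j)"
  defines "J \<equiv> 400 * l * (l + 1) * 2 ^ l"
  assumes l: "1 \<le> l" and e: "0 \<le> e" "e \<le> 1" and d: "1 \<le> d" and c: "\<And>j. \<bar>c j\<bar> \<le> 1"
    and small: "\<And>z. norm z \<le> 1 \<Longrightarrow> norm (z - 1) \<le> 2 / 4 ^ l \<Longrightarrow> norm (f z) \<le> E"
  shows "1 \<le> 4 ^ l * E * (64 ^ l) ^ (2 * J) * 3"
proof -
  \<comment> \<open>The shrinking factor \<open>1 - \<eta>\<close> keeps the denominator of \<open>G\<close> away from 0.\<close>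
  define \<eta> :: real where "\<eta> = 1 / 4 ^ l"
  have \<eta>: "0 < \<eta>" "\<eta> \<le> 1" by (auto simp: \<eta>_def)
  define h where "h z = of_real (1 - \<eta>) * dyadic_avg l z" for z
  have norm_h: "norm (h z) = (1 - \<eta>) * norm (dyadic_avg l z)" for z
    using \<eta> unfolding h_def norm_mult norm_of_real by simp
  have h_le: "norm (h z) \<le> norm (dyadic_avg l z)" for z
    unfolding norm_h using \<eta> by (simp add: mult_left_le_one_le)
  have h_le': "norm (h z) \<le> 1 - \<eta>" if "norm z \<le> 1" for z
    unfolding norm_h using \<eta> norm_dyadic_avg_le_1[OF that, of l] by (simp add: mult_left_le)
  have den: "1 - of_real e * h z ^ d \<noteq> 0" if "norm z \<le> 1" for z
    using norm_one_minus_power_ge[OF e d h_le'[OF that]] \<eta> by auto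
  define G where "G z = f (h z) / (1 - of_real e * h z ^ d)" for z
  \<comment> \<open>The tail of \<open>f\<close> costs one factor \<open>1 / u\<close> through the
    geometric series, the denominator another.\<close>
  have G: "norm (G z) \<le> 1 + (1 - u) ^ 2 ^ l / u\<^sup>2"
    if "norm z \<le> 1" "norm (h z) \<le> 1 - u" "0 < u" "u \<le> 1" for z u
  proof -
    let ?t = "\<Sum>j\<in>{2 ^ l<..N}. of_real (c j) * h z ^ j" and ?q = "1 - of_real e * h z ^ d"
    have "G z = 1 + ?t / ?q"
      using den[OF that(1)] by (simp add: G_def f_def field_simps)
    then have "norm (G z) \<le> 1 + norm ?t / norm ?q"
      using norm_triangle_ineq[of 1 "?t / ?q"] by (simp add: norm_divide)
    also have "norm ?t / norm ?q \<le> ((1 - u) ^ 2 ^ l / u) / u"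
      using norm_power_tail_le[OF c that(2-4)] norm_one_minus_power_ge[OF e d that(2)] that(3,4)
      by (intro frac_le) auto
    finally show ?thesis by (simp add: power2_eq_square)
  qed
  have "dyadic_avg l holomorphic_on cball 0 1" using holomorphic_on_dyadic_avg[of id] by simp
  then have hol: "G holomorphic_on cball 0 1"
    unfolding G_def f_def h_def using den unfolding h_def by (intro holomorphic_intros) auto
  \<comment> \<open>With this many rotations, the angle error \<open>pi / m\<close> times the
    Lipschitz factor \<open>l + 1\<close> is at most \<open>1 / 4 ^ l\<close>. Shrinking by
    \<open>\<eta>\<close> moves \<open>h\<close> by at most as much again, whence the radius
    \<open>2 / 4 ^ l\<close>.\<close>
  define K where "K = 2 * (l + 1) * 4 ^ l"
  define m where "m = real (2 * K + 1)"
  have m: "m = 4 * (real l + 1) * 4 ^ l + 1" by (simp add: m_def K_def algebra_simps)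
  have m0: "m > 0" by (simp add: m_def)
  have "G 0 = 1" using d by (simp add: G_def f_def h_def power_0_left)
  then obtain \<theta> where \<theta>: "\<bar>\<theta>\<bar> \<le> pi / m"
    and ge: "1 \<le> (\<Prod>j\<in>{-int K..int K}. norm (G (cis (\<theta> + 2 * pi * of_int j / m))))"
    using prod_rotations_ge_1[of G K] hol holomorphic_on_subset[OF hol, of "ball 0 1"]
      holomorphic_on_imp_continuous_on[OF hol] unfolding m_def by auto
  let ?t = "\<lambda>j::int. \<theta> + 2 * pi * of_int j / m"
  have "1 \<le> J" using l by (simp add: J_def)
  note ge
  also have "(\<Prod>j\<in>{-int K..int K}. norm (G (cis (?t j)))) \<le>
    (4 ^ l * E) * (64 ^ l) ^ (2 * J) * (1 + 1 / m) ^ (2 * K + 1)"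
  proof (rule prod_three_scales_le)
    have h1: "norm (h (cis \<theta>) - 1) \<le> 2 / 4 ^ l"
    proof -
      have "norm (h (cis \<theta>) - 1) \<le> norm (dyadic_avg l (cis \<theta>) - 1) + norm (of_real \<eta> * dyadic_avg l (cis \<theta>))"
        using norm_triangle_ineq4[of "dyadic_avg l (cis \<theta>) - 1" "of_real \<eta> * dyadic_avg l (cis \<theta>)"]
        by (simp add: h_def algebra_simps)
      also have "norm (of_real \<eta> * dyadic_avg l (cis \<theta>)) \<le> \<eta>"
        using norm_dyadic_avg_le_1[of "cis \<theta>" l] \<eta> by (simp add: norm_mult mult_left_le)
      also have "norm (dyadic_avg l (cis \<theta>) - 1) \<le> (real l + 1) * norm (cis \<theta> - 1)"
        by (rule norm_dyadic_avg_diff_1_le) simp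
      also have "norm (cis \<theta> - 1) \<le> \<bar>\<theta>\<bar>"
        using dist_exp_i_1[of \<theta>] abs_sin_le_one abs_sin_x_le_abs_x[of "\<theta> / 2"] by (simp add: cis_conv_exp)
      also note \<theta>
      also have "(real l + 1) * (pi / m) \<le> (real l + 1) * (4 / (4 * (real l + 1) * 4 ^ l))"
        unfolding m using pi_less_4 by (intro mult_left_mono frac_le) auto
      also have "\<dots> = 1 / 4 ^ l"
      proof -
        have "a * (4 / (4 * a * b)) = 1 / b" if "a > 0" for a b :: real using that by simp
        then show ?thesis by this simp
      qed
      finally show ?thesis by (simp add: \<eta>_def)
    qed
    have "norm (f (h (cis \<theta>))) \<le> E"
      using h1 h_le'[of "cis \<theta>"] \<eta> by (intro small) auto
    moreover have "\<eta> \<le> norm (1 - of_real e * h (cis \<theta>) ^ d)"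
      using norm_one_minus_power_ge[OF e d h_le'[of "cis \<theta>"]] \<eta> by simp
    ultimately have "norm (G (cis \<theta>)) \<le> E / \<eta>"
      unfolding G_def norm_divide using \<eta> by (intro frac_le) (auto intro: order_trans[OF norm_ge_zero])
    then show "norm (G (cis (?t 0))) \<le> 4 ^ l * E" by (simp add: \<eta>_def mult.commute)
    show "0 \<le> 4 ^ l * E" using \<open>norm (f (h (cis \<theta>))) \<le> E\<close> norm_ge_zero[of "f (h (cis \<theta>))"]
      by (simp del: norm_ge_zero)
  next
    fix j :: int assume j: "j \<in> {- int K..int K}"
    have "norm (G (cis (?t j))) \<le> 1 + (1 - \<eta>) ^ 2 ^ l / \<eta>\<^sup>2"
      using \<eta> by (intro G h_le') auto
    also have "(1 - \<eta>) ^ 2 ^ l / \<eta>\<^sup>2 \<le> 1 / \<eta>\<^sup>2"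
      using \<eta> by (intro divide_right_mono power_le_one) auto
    also have "1 + 1 / \<eta>\<^sup>2 = 1 + (16::real) ^ l"
      by (simp add: \<eta>_def power_divide power2_eq_square flip: power_mult_distrib)
    also have "\<dots> \<le> 16 ^ l * 4 ^ l"
    proof -
      have "(2::real) \<le> 4 ^ l" using self_le_power[of "4::real" l] l by simp
      then have "16 ^ l * (2::real) \<le> 16 ^ l * 4 ^ l" by (intro mult_left_mono) auto
      moreover have "(1::real) \<le> 16 ^ l" by simp
      ultimately show ?thesis by linarith
    qed
    also have "\<dots> = (64::real) ^ l" by (simp flip: power_mult_distrib)
    finally show "norm (G (cis (?t j))) \<le> 64 ^ l" by simp
  next
    fix j :: int assume j: "j \<in> {- int K..int K}" and jJ: "int J \<le> \<bar>j\<bar>"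
    have j1: "1 \<le> \<bar>j\<bar>" using jJ \<open>1 \<le> J\<close> by linarith
    have "\<bar>?t j\<bar> \<le> pi / m + 2 * pi * real K / m"
    proof -
      have "\<bar>real_of_int j\<bar> \<le> real K" using j by auto
      then have "\<bar>2 * pi * of_int j / m\<bar> \<le> 2 * pi * real K / m"
        using m0 by (simp add: abs_mult divide_right_mono)
      then show ?thesis using \<theta> by linarith
    qed
    also have "\<dots> = pi"
    proof -
      have "pi + 2 * pi * real K = pi * m" by (simp add: m_def algebra_simps)
      then show ?thesis using m0 by (simp flip: add_divide_distrib)
    qed
    finally have t_le: "\<bar>?t j\<bar> \<le> pi" .
    \<comment> \<open>\<open>J\<close> is chosen to make this hold: far angles are at least 20 times
      the \<open>u\<close> defined below.\<close>
    have "240 * real l / 2 ^ l \<le> pi * real J / m"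
    proof -
      have "1 \<le> (real l + 1) * 4 ^ l"
        using mult_mono[of 1 "real l + 1" 1 "4 ^ l"] by simp
      then have "m \<le> 5 * ((real l + 1) * 4 ^ l)" unfolding m mult.assoc by linarith
      then have "3 * real J / (5 * ((real l + 1) * 4 ^ l)) \<le> pi * real J / m"
        using m0 pi_gt3 by (intro frac_le mult_right_mono) auto
      moreover have "3 * real J / (5 * ((real l + 1) * 4 ^ l)) = 240 * real l / 2 ^ l"
      proof -
        have cancel: "3 * (400 * a * b * L) / (5 * (b * (L * L))) = 240 * a / L"
          if "b > 0" "L > 0" for a b L :: real
          using that by (simp add: field_simps)
        have J: "real J = 400 * real l * (real l + 1) * 2 ^ l" by (simp add: J_def algebra_simps)
        have four: "(4::real) ^ l = 2 ^ l * 2 ^ l" by (simp flip: power_mult_distrib)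
        show ?thesis unfolding J four by (rule cancel) auto
      qed
      ultimately show ?thesis by simp
    qed
    also have "\<dots> \<le> pi * \<bar>of_int j\<bar> / m"
      using jJ m0 by (intro divide_right_mono mult_left_mono) auto
    also have "\<dots> \<le> 2 * pi * \<bar>of_int j\<bar> / m - pi / m"
    proof -
      have "1 \<le> \<bar>real_of_int j\<bar>" using j1 by linarith
      then have "pi / m \<le> pi * \<bar>of_int j\<bar> / m" using m0 by (intro divide_right_mono) auto
      then show ?thesis by simp
    qed
    also have "\<dots> \<le> \<bar>?t j\<bar>"
    proof -
      have "\<bar>2 * pi * of_int j / m\<bar> = 2 * pi * \<bar>of_int j\<bar> / m" using m0 by (simp add: abs_mult)
      then show ?thesis using \<theta> by linarith
    qed
    finally have t_ge: "240 * real l / 2 ^ l \<le> \<bar>?t j\<bar>" .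
    define t where "t = ?t j"
    note t_le = t_le[folded t_def] and t_ge = t_ge[folded t_def]
    \<comment> \<open>The 12 makes \<open>(1 - u) ^ 2 ^ l\<close> at most
      \<open>2 ^ (- 12 l) = 64 ^ (- 2 l)\<close>, which absorbs both
      \<open>1 / u\<^sup>2 <= 4 ^ l\<close> and \<open>m <= 64 ^ l\<close>.\<close>
    define u where "u = 12 * real l / 2 ^ l"
    have u0: "0 < u" using l by (simp add: u_def)
    have ut: "u \<le> \<bar>t\<bar> / 20" using t_ge by (simp add: u_def)
    have u1: "u \<le> 1" using ut t_le pi_less_4 by linarith
    have "pi / 2 ^ l \<le> 240 * real l / 2 ^ l"
      using l pi_less_4 by (intro divide_right_mono) auto
    then have "norm (dyadic_avg l (cis t)) \<le> 1 - \<bar>t\<bar> / 20"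
      using t_ge t_le l by (intro norm_dyadic_avg_cis_le) auto
    then have "norm (h (cis t)) \<le> 1 - u"
      using h_le[of "cis t"] ut by linarith
    then have "norm (G (cis t)) \<le> 1 + (1 - u) ^ 2 ^ l / u\<^sup>2"
      using u0 u1 by (intro G) auto
    also have "(1 - u) ^ 2 ^ l / u\<^sup>2 \<le> 1 / m"
    proof -
      have "(1 - u) ^ 2 ^ l \<le> exp (- u) ^ 2 ^ l"
        using u1 exp_ge_add_one_self[of "- u"] by (intro power_mono) auto
      also have "\<dots> = exp (- real (12 * l))"
        unfolding exp_of_nat_mult[symmetric] by (simp add: u_def)
      also have "\<dots> = 1 / exp 1 ^ (12 * l)"
        by (simp add: exp_minus exp_of_nat_mult[symmetric] divide_inverse)
      also have "\<dots> \<le> 1 / 2 ^ (12 * l)"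
        using exp_ge_add_one_self[of 1] by (intro divide_left_mono power_mono) auto
      also have "\<dots> = 1 / 64 ^ l / 64 ^ l"
        by (simp add: power_mult flip: power_mult_distrib)
      finally have "(1 - u) ^ 2 ^ l / u\<^sup>2 \<le> (1 / 64 ^ l / 64 ^ l) / (1 / 2 ^ l)\<^sup>2"
        using l by (intro frac_le power_mono) (auto simp: u_def divide_right_mono)
      also have "\<dots> = 1 / 64 ^ l * (4 ^ l / 64 ^ l)"
        by (simp add: power_divide power2_eq_square flip: power_mult_distrib)
      also have "\<dots> \<le> 1 / 64 ^ l * 1"
        by (intro mult_left_mono) (auto simp: power_mono)
      also have "m \<le> 64 ^ l"
      proof -
        have "real l + 1 \<le> 2 ^ l" using less_exp[of l] by (metis Suc_leI of_nat_Suc of_nat_le_iff of_nat_numeral of_nat_power add.commute)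
        then have "m \<le> 4 * 2 ^ l * 4 ^ l + 1" unfolding m by (intro add_mono mult_mono) auto
        also have "\<dots> \<le> 8 * 8 ^ l"
        proof -
          have "(2::real) ^ l * 4 ^ l = 8 ^ l" by (simp flip: power_mult_distrib)
          moreover have "(1::real) \<le> 8 ^ l" by simp
          ultimately show ?thesis unfolding mult.assoc by linarith
        qed
        also have "\<dots> \<le> 8 ^ l * 8 ^ l" using self_le_power[of "8::real" l] l by (intro mult_right_mono) auto
        finally show ?thesis by (simp flip: power_mult_distrib)
      qed
      then have "1 / 64 ^ l * 1 \<le> 1 / m" using m0 by (simp add: frac_le)
      finally show ?thesis .
    qed
    finally show "norm (G (cis (?t j))) \<le> 1 + 1 / m" by (simp add: t_def)
  qed (use \<open>1 \<le> J\<close> m0 in auto)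
  finally have prod: "1 \<le> 4 ^ l * E * (64 ^ l) ^ (2 * J) * (1 + 1 / m) ^ (2 * K + 1)" .
  have "(1 + 1 / m) ^ (2 * K + 1) \<le> exp (1 / m) ^ (2 * K + 1)"
    using m0 by (intro power_mono) auto
  also have "\<dots> = exp 1"
    unfolding exp_of_nat_mult[symmetric] m_def[symmetric] using m0 by simp
  also have "\<dots> \<le> 3" by (rule exp_le)
  finally have "(1 + 1 / m) ^ (2 * K + 1) \<le> 3" .
  moreover have "0 \<le> 4 ^ l * E * (64 ^ l) ^ (2 * J)"
  proof (rule ccontr)
    assume "\<not> ?thesis"
    then have "4 ^ l * E * (64 ^ l) ^ (2 * J) * (1 + 1 / m) ^ (2 * K + 1) \<le> 0"
      using m0 by (intro mult_nonpos_nonneg[of "4 ^ l * E * (64 ^ l) ^ (2 * J)"]) auto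
    then show False using prod by linarith
  qed
  ultimately have "4 ^ l * E * (64 ^ l) ^ (2 * J) * (1 + 1 / m) ^ (2 * K + 1) \<le> 4 ^ l * E * (64 ^ l) ^ (2 * J) * 3"
    by (intro mult_left_mono)
  then show ?thesis using prod by linarith
qed

text \<open>Vanishing moments bound \<open>f\<close> near 1 by roughly \<open>2 ^ (- k l)\<close>,
  while the gapped lower bound allows only a loss of \<open>2 ^ (12 * l * J)\<close> and lower-order
  factors. The constant 10000 splits into 9600 for \<open>12 * l * J\<close> and 400 for the
  rest.\<close>

lemma exists_distinct_moment_aux:
  fixes A B :: "nat set"
  defines "k \<equiv> \<lambda>l::nat. 10000 * l ^ 3 * 2 ^ l"
  assumes l: "1 \<le> l" and AB: "A \<subseteq> {..8 ^ l}" "B \<subseteq> {..8 ^ l}"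
    and gapA: "\<And>a b. a \<in> A \<Longrightarrow> b \<in> A \<Longrightarrow> a < b \<Longrightarrow> a + 2 ^ l < b"
    and gapB: "\<And>a b. a \<in> B \<Longrightarrow> b \<in> B \<Longrightarrow> a < b \<Longrightarrow> a + 2 ^ l < b"
    and s: "s \<in> A" "s \<notin> B" "\<And>t. t < s \<Longrightarrow> t \<in> A \<longleftrightarrow> t \<in> B"
  shows "\<exists>m<k l. (\<Sum>a\<in>A. int a ^ m) \<noteq> (\<Sum>a\<in>B. int a ^ m)"
proof (rule ccontr)
  assume neg: "\<not> ?thesis"
  define N where "N = (8::nat) ^ l"
  define D where "D = (A - B) \<union> (B - A)"
  define c' where "c' a = (if a \<in> A then 1 else - 1 :: real)" for a
  define c where "c j = (if s + j \<in> D then c' (s + j) else 0)" for j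
  have fin: "finite A" "finite B" "finite D"
    using AB finite_subset[of _ "{..8 ^ l}"] by (auto simp: D_def)
  have D: "s \<le> a \<and> a \<le> N" if "a \<in> D" for a
    using that s(3) AB by (fastforce simp: D_def N_def not_less[symmetric])
  have van: "(\<Sum>a\<in>D. c' a * real a ^ m) = 0" if "m < k l" for m
  proof -
    have "(\<Sum>a\<in>D. c' a * real a ^ m) = (\<Sum>a\<in>A - B. c' a * real a ^ m) + (\<Sum>a\<in>B - A. c' a * real a ^ m)"
      unfolding D_def using fin by (intro sum.union_disjoint) auto
    also have "\<dots> = (\<Sum>a\<in>A - B. real a ^ m) - (\<Sum>a\<in>B - A. real a ^ m)"
      by (simp add: c'_def sum_negf)
    also have "\<dots> = (\<Sum>a\<in>A. real a ^ m) - (\<Sum>a\<in>B. real a ^ m)"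
      using fin sum.Int_Diff[of A "\<lambda>a. real a ^ m" B] sum.Int_Diff[of B "\<lambda>a. real a ^ m" A]
      by (simp add: Int_commute)
    also have "\<dots> = of_int ((\<Sum>a\<in>A. int a ^ m) - (\<Sum>a\<in>B. int a ^ m))" by simp
    also have "(\<Sum>a\<in>A. int a ^ m) - (\<Sum>a\<in>B. int a ^ m) = 0" using neg that by simp
    finally show ?thesis by simp
  qed
  \<comment> \<open>In the window of length \<open>2 ^ l\<close> after \<open>s\<close>, the gap of
    \<open>A\<close> leaves no element of \<open>A\<close>, and the gap of \<open>B\<close> leaves
    at most one of \<open>B\<close>, which yields the term \<open>- z ^ d\<close>.\<close>
  have "\<exists>d e. 1 \<le> d \<and> 0 \<le> e \<and> e \<le> 1 \<and>
    (\<forall>z::complex. (\<Sum>j\<in>{1..2 ^ l}. of_real (c j) * z ^ j) = - of_real e * z ^ d)"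
  proof -
    have notA: "s + j \<notin> A" if "j \<in> {1..2 ^ l}" for j
      using gapA[OF s(1), of "s + j"] that by auto
    have cj: "c j = (if s + j \<in> B then - 1 else 0)" if "j \<in> {1..2 ^ l}" for j
      using notA[OF that] by (auto simp: c_def c'_def D_def)
    show ?thesis
    proof (cases "\<exists>d\<in>{1..2 ^ l}. s + d \<in> B")
      case True
      then obtain d where d: "d \<in> {1..2 ^ l}" "s + d \<in> B" by blast
      have "s + j \<notin> B" if "j \<in> {1..2 ^ l}" "j \<noteq> d" for j
        using gapB[OF d(2), of "s + j"] gapB[of "s + j" "s + d"] d that by (cases "j < d") auto
      then have "c j = (if j = d then - 1 else 0)" if "j \<in> {1..2 ^ l}" for j
        using cj[OF that] d(2) that by auto
      then have "(\<Sum>j\<in>{1..2 ^ l}. of_real (c j) * z ^ j) = (\<Sum>j\<in>{1..2 ^ l}. if j = d then - (z ^ j) else 0)"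
        for z :: complex by (intro sum.cong) auto
      then show ?thesis using d by (intro exI[of _ d] exI[of _ 1]) auto
    next
      case False
      then have "(\<Sum>j\<in>{1..2 ^ l}. of_real (c j) * z ^ j) = 0" for z :: complex
        using cj by (intro sum.neutral) auto
      then show ?thesis by (intro exI[of _ 1] exI[of _ 0]) auto
    qed
  qed
  then obtain d e where de: "1 \<le> d" "0 \<le> e" "e \<le> 1"
    "\<And>z::complex. (\<Sum>j\<in>{1..2 ^ l}. of_real (c j) * z ^ j) = - of_real e * z ^ d" by blast
  have f_eq: "1 - of_real e * z ^ d + (\<Sum>j\<in>{2 ^ l<..N}. of_real (c j) * z ^ j) =
    (\<Sum>a\<in>D. of_real (c' a) * z ^ (a - s))" for z :: complex
  proof -
    have "(2::nat) ^ l \<le> N" unfolding N_def by (rule power_mono) auto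
    then have "{..N} = insert 0 ({1..2 ^ l} \<union> {2 ^ l<..N})" by auto
    moreover have "(\<Sum>j\<in>{1..2 ^ l} \<union> {2 ^ l<..N}. of_real (c j) * z ^ j) =
      (\<Sum>j\<in>{1..2 ^ l}. of_real (c j) * z ^ j) + (\<Sum>j\<in>{2 ^ l<..N}. of_real (c j) * z ^ j)"
      by (rule sum.union_disjoint) auto
    ultimately have "(\<Sum>j\<in>{..N}. of_real (c j) * z ^ j) = of_real (c 0) +
      ((\<Sum>j\<in>{1..2 ^ l}. of_real (c j) * z ^ j) + (\<Sum>j\<in>{2 ^ l<..N}. of_real (c j) * z ^ j))"
      by simp
    also have "c 0 = 1" using s by (simp add: c_def c'_def D_def)
    finally have "1 - of_real e * z ^ d + (\<Sum>j\<in>{2 ^ l<..N}. of_real (c j) * z ^ j) =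
      (\<Sum>j\<in>{..N}. of_real (c j) * z ^ j)" using de(4) by simp
    also have "\<dots> = (\<Sum>j\<in>{j \<in> {..N}. s + j \<in> D}. of_real (c' (s + j)) * z ^ j)"
      unfolding sum.inter_filter[OF finite_atMost] by (intro sum.cong) (auto simp: c_def)
    also have "\<dots> = (\<Sum>a\<in>D. of_real (c' a) * z ^ (a - s))"
      by (rule sum.reindex_bij_witness[of _ "\<lambda>a. a - s" "\<lambda>j. s + j"]) (use D in fastforce)+
    finally show ?thesis .
  qed
  \<comment> \<open>On the radius \<open>2 / 4 ^ l\<close> the growth factor is only
    \<open>exp (4 * 2 ^ l)\<close>, negligible against \<open>2 ^ k l\<close>.\<close>
  define E where "E = real (8 ^ l + 1) * (1 + 4 / 4 ^ l) ^ 8 ^ l / 2 ^ k l"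
  define J where "J = 400 * l * (l + 1) * 2 ^ l"
  have cD: "card D \<le> 8 ^ l + 1"
    using card_mono[of "{..N}" D] D by (auto simp: N_def)
  have "1 \<le> 4 ^ l * E * (64 ^ l) ^ (2 * J) * 3"
    unfolding J_def
  proof (rule gapped_polynomial_lower_bound[where c = c and N = N and d = d and e = e])
    fix z :: complex assume z: "norm z \<le> 1" "norm (z - 1) \<le> 2 / 4 ^ l"
    have "norm (\<Sum>a\<in>D. of_real (c' a) * z ^ (a - s)) \<le> real (card D) * (1 + 2 * norm (z - 1)) ^ N / 2 ^ k l"
      by (rule norm_le_of_vanishing_moments) (use fin D van in \<open>auto simp: c'_def\<close>)
    also have "\<dots> \<le> E"
    proof -
      have "real (card D) \<le> real (8 ^ l + 1)" using cD by (simp only: of_nat_le_iff)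
      then show ?thesis
        unfolding E_def N_def using z(2) by (intro divide_right_mono mult_mono power_mono) auto
    qed
    finally show "norm (1 - of_real e * z ^ d + (\<Sum>j\<in>{2 ^ l<..N}. of_real (c j) * z ^ j)) \<le> E"
      unfolding f_eq .
  qed (use l de in \<open>auto simp: c_def c'_def\<close>)
  also have "E \<le> 2 ^ (3 * l + 1) * 2 ^ (8 * 2 ^ l) / 2 ^ k l"
    unfolding E_def
  proof (intro divide_right_mono mult_mono)
    have "(1::real) \<le> 8 ^ l" by simp
    then show "real (8 ^ l + 1) \<le> 2 ^ (3 * l + 1)" by (simp add: power_add power_mult)
    have "(1 + 4 / 4 ^ l) ^ 8 ^ l \<le> exp (4 / 4 ^ l :: real) ^ 8 ^ l"
      by (intro power_mono) auto
    also have "\<dots> = exp (real (8 ^ l) * (4 / 4 ^ l))" by (simp only: exp_of_nat_mult)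
    also have "real (8 ^ l) * (4 / 4 ^ l) = real (4 * 2 ^ l) * 1"
      by (simp add: field_simps flip: power_mult_distrib)
    also have "exp \<dots> = exp 1 ^ (4 * 2 ^ l)" by (rule exp_of_nat_mult)
    also have "\<dots> \<le> 4 ^ (4 * 2 ^ l)" using exp_le by (intro power_mono) auto
    also have "\<dots> = 2 ^ (8 * 2 ^ l)"
      using power_mult[of "2::real" 2 "4 * 2 ^ l"] by simp
    finally show "(1 + 4 / 4 ^ l) ^ 8 ^ l \<le> (2::real) ^ (8 * 2 ^ l)" .
  qed auto
  also have "4 ^ l * (2 ^ (3 * l + 1) * 2 ^ (8 * 2 ^ l) / 2 ^ k l) * (64 ^ l) ^ (2 * J) * 3 \<le>
    (2::real) ^ (2 * l) * (2 ^ (3 * l + 1) * 2 ^ (8 * 2 ^ l) / 2 ^ k l) * 2 ^ (12 * l * J) * 2 ^ 2"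
  proof -
    have "(4::real) ^ l = 2 ^ (2 * l)" by (simp add: power_mult)
    moreover have "((64::real) ^ l) ^ (2 * J) = 2 ^ (12 * l * J)"
      using power_mult[of "2::real" 6 "l * (2 * J)"] by (simp add: power_mult[symmetric] mult_ac)
    ultimately show ?thesis by (intro mult_mono) auto
  qed
  also have "\<dots> = 2 ^ (2 * l + (3 * l + 1) + 8 * 2 ^ l + 12 * l * J + 2) / 2 ^ k l"
    unfolding power_add by simp
  finally have "(2::real) ^ k l \<le> 2 ^ (2 * l + (3 * l + 1) + 8 * 2 ^ l + 12 * l * J + 2)"
    by (simp add: field_simps)
  then have "k l \<le> 2 * l + (3 * l + 1) + 8 * 2 ^ l + 12 * l * J + 2"
    by (rule power_le_imp_le_exp[rotated]) simp
  moreover have "12 * l * J \<le> 9600 * l ^ 3 * 2 ^ l"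
  proof -
    have "12 * l * J = 4800 * (l ^ 2 * (l + 1)) * 2 ^ l"
      by (simp add: J_def power2_eq_square algebra_simps)
    also have "l ^ 2 * (l + 1) \<le> l ^ 2 * (2 * l)" using l by (intro mult_left_mono) auto
    also have "\<dots> = 2 * l ^ 3" by (simp add: power2_eq_square power3_eq_cube)
    finally show ?thesis by simp
  qed
  moreover have "2 * l + (3 * l + 1) + 8 * 2 ^ l + 2 < 400 * l ^ 3 * 2 ^ l"
  proof -
    have "l < 2 ^ l" by (rule less_exp)
    then have "2 * l + (3 * l + 1) + 8 * 2 ^ l + 2 < 400 * 1 * 2 ^ l" by linarith
    also have "\<dots> \<le> 400 * l ^ 3 * 2 ^ l" using l by (intro mult_mono) auto
    finally show ?thesis .
  qed
  ultimately show False unfolding k_def by linarith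
qed

lemma exists_distinct_moment:
  fixes A B :: "nat set"
  assumes "1 \<le> l" "A \<subseteq> {..8 ^ l}" "B \<subseteq> {..8 ^ l}" "A \<noteq> B"
    and "\<And>a b. a \<in> A \<Longrightarrow> b \<in> A \<Longrightarrow> a < b \<Longrightarrow> a + 2 ^ l < b"
    and "\<And>a b. a \<in> B \<Longrightarrow> b \<in> B \<Longrightarrow> a < b \<Longrightarrow> a + 2 ^ l < b"
  shows "\<exists>m<10000 * l ^ 3 * 2 ^ l. (\<Sum>a\<in>A. int a ^ m) \<noteq> (\<Sum>a\<in>B. int a ^ m)"
proof -
  define s where "s = (LEAST s. (s \<in> A) \<noteq> (s \<in> B))"
  have ex: "\<exists>s. (s \<in> A) \<noteq> (s \<in> B)" using assms(4) by blast
  have s: "(s \<in> A) \<noteq> (s \<in> B)" unfolding s_def by (rule LeastI_ex[OF ex])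
  have min: "t \<in> A \<longleftrightarrow> t \<in> B" if "t < s" for t
    using not_less_Least[of t "\<lambda>s. (s \<in> A) \<noteq> (s \<in> B)"] that unfolding s_def by blast
  show ?thesis
  proof (cases "s \<in> A")
    case True
    then show ?thesis using exists_distinct_moment_aux[of l A B s] assms s min by blast
  next
    case False
    then have "\<exists>m<10000 * l ^ 3 * 2 ^ l. (\<Sum>a\<in>B. int a ^ m) \<noteq> (\<Sum>a\<in>A. int a ^ m)"
      using exists_distinct_moment_aux[of l B A s] assms s min by blast
    then show ?thesis by metis
  qed
qed

section \<open>The separating automaton\<close>

text \<open>Replacing each \<open>a\<close> by its residue expresses the power sum modulo
  \<open>p\<close> through the residue counts. The contrapositive turns distinct moments modulo
  \<open>p\<close> into a residue class with distinct counts.\<close>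

lemma moments_cong_of_residue_counts:
  assumes fin: "finite A" "finite B" and p: "p > 0"
    and eq: "\<And>i. i < p \<Longrightarrow> card (residue_class p i A) = card (residue_class p i B)"
  shows "int p dvd (\<Sum>a\<in>A. int a ^ m) - (\<Sum>a\<in>B. int a ^ m)"
proof -
  have *: "[(\<Sum>a\<in>X. int a ^ m) = (\<Sum>i<p. int (card (residue_class p i X)) * int i ^ m)] (mod int p)"
    if "finite X" for X
  proof -
    have "(\<Sum>a\<in>X. int a ^ m) = (\<Sum>i<p. \<Sum>a\<in>{a \<in> X. a mod p = i}. int a ^ m)"
      by (rule sum.group[symmetric]) (use that p in auto)
    also have "[\<dots> = (\<Sum>i<p. \<Sum>a\<in>{a \<in> X. a mod p = i}. int i ^ m)] (mod int p)"
      by (intro cong_sum cong_pow) (auto simp: cong_def zmod_int)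
    also have "(\<Sum>i<p. \<Sum>a\<in>{a \<in> X. a mod p = i}. int i ^ m) =
      (\<Sum>i<p. int (card (residue_class p i X)) * int i ^ m)"
      by (simp add: residue_class_def)
    finally show ?thesis .
  qed
  have "[(\<Sum>a\<in>A. int a ^ m) = (\<Sum>a\<in>B. int a ^ m)] (mod int p)"
    using *[OF fin(1)] *[OF fin(2)] eq by (simp add: cong_def)
  then show ?thesis by (simp add: cong_iff_dvd_diff)
qed

text \<open>The bit length of the power sums controls \<open>p <= 70000 * l ^ 4 * 2 ^ l\<close>, and
  that of the counts controls \<open>q <= 8 * l\<close>. The bound on the states is that for
  \<open>2 * p * q\<close>.\<close>

lemma separating_dfa:
  fixes x y :: "bool list"
  assumes "x \<noteq> y" "length x = length y" and l: "1 \<le> l" and n: "length x + 2 * 2 ^ l \<le> 8 ^ l"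
  shows "\<exists>M::nat dfa. is_dfa M \<and> card (states M) \<le> 1120000 * l ^ 5 * 2 ^ l \<and> accepts M x \<and> \<not> accepts M y"
proof -
  \<comment> \<open>Padding on the left makes room for the pattern even if the words differ early; the automaton starts
    in the state reached after reading the padding.\<close>
  define z where "z = replicate (2 * 2 ^ l) False"
  define k :: nat where "k = 10000 * l ^ 3 * 2 ^ l"
  obtain w where w: "length w = 2 * 2 ^ l + 1" "occ w (z @ x) \<noteq> occ w (z @ y)"
    and gap: "\<And>u a b. a \<in> occ w u \<Longrightarrow> b \<in> occ w u \<Longrightarrow> a < b \<Longrightarrow> a + 2 ^ l < b"
    by (rule separated_distinguishing_pattern[of "z @ x" "z @ y" "2 ^ l"])
       (use assms in \<open>auto simp: z_def\<close>)
  define A B where "A = occ w (z @ x)" and "B = occ w (z @ y)"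
  have sub: "A \<subseteq> {..8 ^ l}" "B \<subseteq> {..8 ^ l}"
    using occ_subset[of w "z @ x"] occ_subset[of w "z @ y"] n assms(2)
    unfolding A_def B_def by (auto simp: z_def)
  have fin: "finite A" "finite B" by (simp_all add: A_def B_def)
  have cA: "card X < 2 ^ (3 * l + 1)" if "X \<subseteq> {..8 ^ l}" for X :: "nat set"
  proof -
    have "card X \<le> card {..(8::nat) ^ l}" using that by (intro card_mono) auto
    also have "\<dots> < 2 * 8 ^ l" using self_le_power[of "8::nat" l] l by simp
    finally show ?thesis by (simp add: power_mult)
  qed
  obtain m where m: "m < k" "(\<Sum>a\<in>A. int a ^ m) \<noteq> (\<Sum>a\<in>B. int a ^ m)"
    using exists_distinct_moment[OF l sub] w(2) gap unfolding A_def B_def k_def by blast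
  \<comment> \<open>At most \<open>2 ^ (3 * l + 1)\<close> summands, each at most
    \<open>2 ^ (3 * l * k)\<close>.\<close>
  define r where "r = 3 * l * k + 3 * l + 1"
  have bnd: "0 \<le> (\<Sum>a\<in>X. int a ^ m)" "(\<Sum>a\<in>X. int a ^ m) < 2 ^ r" if "X \<subseteq> {..8 ^ l}" for X :: "nat set"
  proof -
    have "(\<Sum>a\<in>X. int a ^ m) \<le> (\<Sum>a\<in>X. (8 ^ l) ^ k)"
    proof (rule sum_mono)
      fix a assume "a \<in> X"
      then have "int a \<le> 8 ^ l" using that by auto
      then have "int a ^ m \<le> (8 ^ l) ^ m" by (intro power_mono) auto
      also have "\<dots> \<le> (8 ^ l) ^ k" using m(1) by (intro power_increasing) auto
      finally show "int a ^ m \<le> (8 ^ l) ^ k" .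
    qed
    also have "\<dots> = int (card X) * 2 ^ (3 * l * k)" by (simp add: power_mult)
    also have "\<dots> < 2 ^ (3 * l + 1) * 2 ^ (3 * l * k)"
    proof -
      have "int (card X) < int (2 ^ (3 * l + 1))" using cA[OF that] by (simp only: of_nat_less_iff)
      then show ?thesis by (intro mult_strict_right_mono) auto
    qed
    also have "\<dots> = 2 ^ r" by (simp add: r_def power_add)
    finally show "(\<Sum>a\<in>X. int a ^ m) < 2 ^ r" .
  qed (auto intro: sum_nonneg)
  have "\<bar>(\<Sum>a\<in>A. int a ^ m) - (\<Sum>a\<in>B. int a ^ m)\<bar> < 2 ^ r"
    using bnd[OF sub(1)] bnd[OF sub(2)] by linarith
  then obtain j where j: "1 \<le> j" "j \<le> 2 * r" "\<not> int j dvd (\<Sum>a\<in>A. int a ^ m) - (\<Sum>a\<in>B. int a ^ m)"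
    using exists_small_nondivisor m(2) by (metis eq_iff_diff_eq_0)
  \<comment> \<open>A multiple of the non-divisor \<open>j\<close> is again a non-divisor; this one
    is large enough for \<open>length w <= p\<close>.\<close>
  define p where "p = j * (2 * 2 ^ l div j + 1)"
  have p_le: "p \<le> 2 * 2 ^ l + 2 * r"
  proof -
    have "j * (2 * 2 ^ l div j) \<le> 2 * 2 ^ l" by (rule times_div_less_eq_dividend)
    then show ?thesis unfolding p_def distrib_left using j(2) by linarith
  qed
  have p_ge: "2 * 2 ^ l + 1 \<le> p"
  proof -
    have "2 * 2 ^ l < j + j * (2 * 2 ^ l div j)" using j(1) by (intro dividend_less_times_div) auto
    then show ?thesis unfolding p_def distrib_left by linarith
  qed
  have "\<not> int p dvd (\<Sum>a\<in>A. int a ^ m) - (\<Sum>a\<in>B. int a ^ m)"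
    using j(3) dvd_trans[of "int j" "int p"] by (auto simp: p_def)
  then obtain i where i: "i < p" "card (residue_class p i A) \<noteq> card (residue_class p i B)"
    using moments_cong_of_residue_counts[OF fin, of p m] p_ge by auto
  have "\<bar>int (card (residue_class p i A)) - int (card (residue_class p i B))\<bar> < 2 ^ (3 * l + 1)"
  proof -
    have "int (card (residue_class p i X)) < 2 ^ (3 * l + 1)" if "X \<subseteq> {..8 ^ l}" for X
    proof -
      have "card (residue_class p i X) < 2 ^ (3 * l + 1)"
        by (rule cA) (use that in \<open>auto simp: residue_class_def\<close>)
      then have "int (card (residue_class p i X)) < int (2 ^ (3 * l + 1))" by (simp only: of_nat_less_iff)
      then show ?thesis by simp
    qed
    from this[OF sub(1)] this[OF sub(2)] show ?thesis by linarith
  qed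
  then obtain q where q: "1 \<le> q" "q \<le> 2 * (3 * l + 1)"
    "\<not> int q dvd int (card (residue_class p i A)) - int (card (residue_class p i B))"
    using exists_small_nondivisor i(2) by (metis eq_iff_diff_eq_0 of_nat_eq_iff)
  have "card (residue_class p i A) mod q \<noteq> card (residue_class p i B) mod q"
    using q(3) by (metis mod_eq_dvd_iff of_nat_mod)
  then obtain M :: "nat dfa" where M: "is_dfa M" "card (states M) \<le> 2 * p * q" "accepts M x" "\<not> accepts M y"
    using residue_count_dfa[of w p i q z x y] w(1) p_ge i(1) q(1) unfolding A_def B_def by force
  have l1: "1 \<le> l ^ 4" "l \<le> l ^ 4" using l self_le_power[of l 4] by auto
  have "p \<le> 70000 * l ^ 4 * 2 ^ l"
  proof -
    have "6 * l * k = 60000 * l ^ 4 * 2 ^ l"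
      by (simp add: k_def power_numeral_reduce)
    moreover have "1 * 2 ^ l \<le> l ^ 4 * 2 ^ l" "l * 1 \<le> l ^ 4 * 2 ^ l" "1 * 1 \<le> l ^ 4 * 2 ^ l"
      using l1 by (intro mult_mono; simp)+
    moreover have "2 * r = 6 * l * k + 6 * l + 2" by (simp add: r_def)
    ultimately show ?thesis using p_le by linarith
  qed
  moreover have "q \<le> 8 * l" using q(2) l by presburger
  ultimately have "2 * p * q \<le> 2 * (70000 * l ^ 4 * 2 ^ l) * (8 * l)" by (intro mult_mono) auto
  also have "\<dots> = 1120000 * l ^ 5 * 2 ^ l" by (simp add: power_numeral_reduce)
  finally show ?thesis using M by (meson order_trans)
qed

theorem theorem1:
  shows "\<exists>C::real. C > 0 \<and>
    (\<forall>(n::nat) (x::bool list) (y::bool list).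
       n \<ge> 2 \<longrightarrow> length x = n \<longrightarrow> length y = n \<longrightarrow> x \<noteq> y \<longrightarrow>
       (\<exists>M::nat dfa. is_dfa M \<and>
          real (card (states M)) \<le> C * real n powr (1 / 3) * ln (real n) ^ 7 \<and>
          accepts M x \<and> \<not> accepts M y))"
proof (intro exI[of _ "1120000 * (5 ^ 5 * 4) * 4"] conjI allI impI)
  fix n :: nat and x y :: "bool list"
  assume n: "n \<ge> 2" and x: "length x = n" and y: "length y = n" and ne: "x \<noteq> y"
  \<comment> \<open>Rounding up gives \<open>n <= 8 ^ k\<close> at the cost of a factor 2 in
    \<open>2 ^ k\<close>. The extra 1 in \<open>l\<close> makes room for the padding.\<close>
  define k where "k = nat \<lceil>log 8 (real n)\<rceil>"
  define l where "l = k + 1"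
  have log0: "log 8 (real n) > 0" using n by simp
  have k_ge: "log 8 (real n) \<le> real k" and k_le: "real k \<le> log 8 (real n) + 1"
    unfolding k_def using log0 by linarith+
  have k1: "1 \<le> k" using k_ge log0 by linarith
  have "real n \<le> 8 powr real k" using k_ge n by (simp add: log_le_iff)
  then have "real n \<le> real (8 ^ k)" by (simp add: powr_realpow)
  then have "n \<le> 8 ^ k" by (simp only: of_nat_le_iff)
  moreover have "4 * 2 ^ k \<le> (7::nat) * 8 ^ k" using power_mono[of "2::nat" 8 k] by linarith
  ultimately have "length x + 2 * 2 ^ l \<le> 8 ^ l" using x by (simp add: l_def)
  then obtain M :: "nat dfa" where M: "is_dfa M" "card (states M) \<le> 1120000 * l ^ 5 * 2 ^ l"
    "accepts M x" "\<not> accepts M y"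
    using separating_dfa[OF ne, of l] x y by (auto simp: l_def)
  have ln_n: "1 / 2 \<le> ln (real n)"
  proof -
    have "ln 2 \<le> ln (real n)" using n by simp
    then show ?thesis using ln2_ge_two_thirds by linarith
  qed
  have "log 8 (real n) \<le> ln (real n)"
  proof -
    have "ln (8::real) = 3 * ln 2" using ln_realpow[of "2::real" 3] by simp
    then have "1 \<le> ln (8::real)" using ln2_ge_two_thirds by linarith
    then show ?thesis using ln_n by (simp add: log_def divide_le_eq mult_le_cancel_left1)
  qed
  \<comment> \<open>\<open>l\<close> is at most \<open>log 8 n + 2\<close>, and
    \<open>2 <= 4 * ln n\<close> because \<open>ln n >= 1 / 2\<close>.\<close>
  then have l_le: "real l \<le> 5 * ln (real n)" using k_le ln_n by (simp add: l_def)
  have "real l ^ 5 \<le> (5 * ln (real n)) ^ 5" using l_le by (intro power_mono) auto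
  also have "\<dots> = 5 ^ 5 * (ln (real n) ^ 5 * 1)" by (simp add: power_mult_distrib)
  \<comment> \<open>The construction yields the fifth power of the logarithm; the factor
    \<open>4 * ln n ^ 2 >= 1\<close> raises it to the seventh.\<close>
  also have "\<dots> \<le> 5 ^ 5 * (ln (real n) ^ 5 * (4 * ln (real n) ^ 2))"
  proof -
    have "(1 / 2)\<^sup>2 \<le> ln (real n) ^ 2" using ln_n by (intro power_mono) auto
    then show ?thesis using ln_n by (intro mult_left_mono) (auto simp: power2_eq_square)
  qed
  also have "\<dots> = 5 ^ 5 * 4 * ln (real n) ^ 7" by (simp add: power_numeral_reduce)
  finally have l5: "real l ^ 5 \<le> 5 ^ 5 * 4 * ln (real n) ^ 7" .
  have "(2::real) ^ l = 2 * 2 powr real k" by (simp add: l_def powr_realpow)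
  also have "\<dots> \<le> 2 * 2 powr (log 8 (real n) + 1)" using k_le by simp
  also have "\<dots> = 4 * 2 powr (log 8 (real n))" by (simp add: powr_add)
  also have "2 powr (log 8 (real n)) = real n powr (1 / 3)"
  proof -
    have "ln (8::real) = 3 * ln 2" using ln_realpow[of "2::real" 3] by simp
    then show ?thesis using n by (simp add: powr_def log_def)
  qed
  finally have l2: "(2::real) ^ l \<le> 4 * real n powr (1 / 3)" .
  have "real (card (states M)) \<le> real (1120000 * l ^ 5 * 2 ^ l)" using M(2) by (simp only: of_nat_le_iff)
  also have "\<dots> = 1120000 * (real l ^ 5 * 2 ^ l)" by simp
  also have "\<dots> \<le> 1120000 * ((5 ^ 5 * 4 * ln (real n) ^ 7) * (4 * real n powr (1 / 3)))"
    using l5 l2 ln_n by (intro mult_left_mono mult_mono) auto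
  also have "\<dots> = 1120000 * (5 ^ 5 * 4) * 4 * real n powr (1 / 3) * ln (real n) ^ 7"
    by (simp only: mult_ac)
  finally show "\<exists>M::nat dfa. is_dfa M \<and>
      real (card (states M)) \<le> 1120000 * (5 ^ 5 * 4) * 4 * real n powr (1 / 3) * ln (real n) ^ 7 \<and>
      accepts M x \<and> \<not> accepts M y"
    using M by blast
qed simp

end
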